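(* There is an isomorphism of 2-categories $$\mathbf{sDMC}\;\cong\;\mathbf{CompCat}^{\mathrm{str2}}_{\mathrm{sub}},$$ where $\mathbf{sDMC}$ is the 2-category of structured display map categories and $\mathbf{CompCat}^{\mathrm{str2}}_{\mathrm{sub}}$ is the 2-category of full comprehension categories whose comprehension functor $\chi$ is a subcategory inclusion, with strict maps as 1-cells and all transformations as 2-cells.
   Context: **Comprehension categories.** A comprehension category $(\mathcal C,\mathcal T,p,\chi)$ is a category $\mathcal C$, a fibration $p:\mathcal T\to\mathcal C$, and a functor $\chi:\mathcal T\to\mathcal C^{\to}$ (comprehension) to the arrow category with $\mathrm{cod}\circ\chi=p$ strictly, sending $p$-cartesian maps to pullback squares. A *strict map* $(F,\bar F):(\mathcal C,\mathcal T,p,\chi)\to(\mathcal C',\mathcal T',p',\chi')$ is a functor $F:\mathcal C\to\mathcal C'$ and a functor $\bar F:\mathcal T\to\mathcal T'$ strictly over $F$, sending $p$-cartesian maps to $p'$-cartesian maps, with $\chi'\bar F=F^{\to}\chi$. A *transformation* $(F,\bar F)\Rightarrow(G,\bar G)$ of strict maps is a natural transformation $\alpha:F\Rightarrow G$ and another $\bar\alpha:\bar F\Rightarrow\bar G$ strictly over $\alpha$, such that for each $A\in\mathcal T$ with $p(A)=\Gamma$, the domain component of $\chi'(\bar\alpha_A)$ equals $\alpha_{\Gamma.A}$, where $\Gamma.A$ is the domain of $\chi(A)$. A comprehension category is *full* if $\chi$ is fully faithful, and *subcategorical* (subscript $\mathrm{sub}$) if $\chi$ is a full subcategory inclusion (full,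 faithful, injective on objects; $\mathcal T$ is identified with its image, a full subcategory of $\mathcal C^{\to}$). **Structured display map categories.** A display structure on a category $\mathcal C$ is a class $\mathcal D$ of morphisms (display maps), not required to be closed under isomorphism, such that for any display map $d$ and any map $f$ into its target there is a display map $f^*d$ in $\mathcal D$ that is a pullback of $d$ along $f$. A structured display map category is a category with a display structure. $\mathbf{sDMC}$ is the 2-category with these as objects, functors preserving display maps and pullbacks of display maps as 1-cells, and natural transformations as 2-cells. 2-categories are strict. *)

theory Defs
  imports "HOL-Library.FuncSet"
begin

section \<open>Categories, functors, natural transformations\<close>

text \<open>
  Objects and arrows are carrier sets inside two types. All structure maps are required to be
  \<^const>\<open>undefined\<close> outside their intended domain. Hence HOL equality of categories, of functors
  and of natural transformations is mathematical (strict) equality.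
\<close>

record ('o, 'a) cat =
  Obj :: "'o set"
  Arr :: "'a set"
  Dom :: "'a \<Rightarrow> 'o"
  Cod :: "'a \<Rightarrow> 'o"
  Ident :: "'o \<Rightarrow> 'a"
  Comp :: "'a \<Rightarrow> 'a \<Rightarrow> 'a"  \<comment> \<open>\<open>Comp C g f\<close> is \<open>g\<close> after \<open>f\<close>\<close>

definition in_hom :: "('o, 'a) cat \<Rightarrow> 'a \<Rightarrow> 'o \<Rightarrow> 'o \<Rightarrow> bool" where
  "in_hom C f a b \<longleftrightarrow> f \<in> Arr C \<and> Dom C f = a \<and> Cod C f = b"

locale category =
  fixes C :: "('o, 'a) cat"
  assumes Dom_ext: "Dom C \<in> Arr C \<rightarrow>\<^sub>E Obj C"
    and Cod_ext: "Cod C \<in> Arr C \<rightarrow>\<^sub>E Obj C"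
    and Ident_ext: "Ident C \<in> extensional (Obj C)"
    and Comp_ext: "\<not> (f \<in> Arr C \<and> g \<in> Arr C \<and> Dom C g = Cod C f) \<Longrightarrow> Comp C g f = undefined"
    and Ident_in_hom: "a \<in> Obj C \<Longrightarrow> in_hom C (Ident C a) a a"
    and Comp_in_hom: "in_hom C f a b \<Longrightarrow> in_hom C g b c \<Longrightarrow> in_hom C (Comp C g f) a c"
    and Comp_Ident_right: "in_hom C f a b \<Longrightarrow> Comp C f (Ident C a) = f"
    and Comp_Ident_left: "in_hom C f a b \<Longrightarrow> Comp C (Ident C b) f = f"
    and Comp_assoc: "in_hom C f a b \<Longrightarrow> in_hom C g b c \<Longrightarrow> in_hom C h c d \<Longrightarrow>
          Comp C h (Comp C g f) = Comp C (Comp C h g) f"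

definition mk_cat :: "'o set \<Rightarrow> 'a set \<Rightarrow> ('a \<Rightarrow> 'o) \<Rightarrow> ('a \<Rightarrow> 'o) \<Rightarrow> ('o \<Rightarrow> 'a) \<Rightarrow>
    ('a \<Rightarrow> 'a \<Rightarrow> 'a) \<Rightarrow> ('o, 'a) cat" where
  "mk_cat Ob Ar d c i m =
     \<lparr> Obj = Ob, Arr = Ar, Dom = restrict d Ar, Cod = restrict c Ar, Ident = restrict i Ob,
       Comp = (\<lambda>g f. if f \<in> Ar \<and> g \<in> Ar \<and> d g = c f then m g f else undefined) \<rparr>"

record ('o, 'a, 'p, 'b) ftor =
  OMap :: "'o \<Rightarrow> 'p"
  AMap :: "'a \<Rightarrow> 'b"

locale cat_functor = A: category A + B: category B
  for A :: "('o, 'a) cat" and B :: "('p, 'b) cat" +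
  fixes F :: "('o, 'a, 'p, 'b) ftor"
  assumes OMap_ext: "OMap F \<in> Obj A \<rightarrow>\<^sub>E Obj B"
    and AMap_ext: "AMap F \<in> extensional (Arr A)"
    and AMap_in_hom: "in_hom A f a b \<Longrightarrow> in_hom B (AMap F f) (OMap F a) (OMap F b)"
    and AMap_Ident: "a \<in> Obj A \<Longrightarrow> AMap F (Ident A a) = Ident B (OMap F a)"
    and AMap_Comp: "in_hom A f a b \<Longrightarrow> in_hom A g b c \<Longrightarrow>
          AMap F (Comp A g f) = Comp B (AMap F g) (AMap F f)"

definition mk_ftor :: "('o, 'a) cat \<Rightarrow> ('o \<Rightarrow> 'p) \<Rightarrow> ('a \<Rightarrow> 'b) \<Rightarrow> ('o, 'a, 'p, 'b) ftor" where
  "mk_ftor A ob ar = \<lparr> OMap = restrict ob (Obj A), AMap = restrict ar (Arr A) \<rparr>"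

definition fid :: "('o, 'a) cat \<Rightarrow> ('o, 'a, 'o, 'a) ftor" where
  "fid A = mk_ftor A (\<lambda>a. a) (\<lambda>f. f)"

definition fcomp :: "('o, 'a) cat \<Rightarrow> ('p, 'b, 'q, 'c) ftor \<Rightarrow> ('o, 'a, 'p, 'b) ftor \<Rightarrow>
    ('o, 'a, 'q, 'c) ftor" where
  "fcomp A G F = mk_ftor A (OMap G \<circ> OMap F) (AMap G \<circ> AMap F)"

definition full_functor :: "('o, 'a) cat \<Rightarrow> ('p, 'b) cat \<Rightarrow> ('o, 'a, 'p, 'b) ftor \<Rightarrow> bool" where
  "full_functor A B F \<longleftrightarrow>
     (\<forall>a\<in>Obj A. \<forall>b\<in>Obj A. \<forall>g. in_hom B g (OMap F a) (OMap F b) \<longrightarrow>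
        (\<exists>f. in_hom A f a b \<and> AMap F f = g))"

definition faithful_functor :: "('o, 'a) cat \<Rightarrow> ('o, 'a, 'p, 'b) ftor \<Rightarrow> bool" where
  "faithful_functor A F \<longleftrightarrow>
     (\<forall>a b f g. in_hom A f a b \<and> in_hom A g a b \<and> AMap F f = AMap F g \<longrightarrow> f = g)"

locale nat_trans = F: cat_functor A B F + G: cat_functor A B G
  for A :: "('o, 'a) cat" and B :: "('p, 'b) cat" and F G +
  fixes \<alpha> :: "'o \<Rightarrow> 'b"
  assumes component_ext: "\<alpha> \<in> extensional (Obj A)"
    and component_in_hom: "a \<in> Obj A \<Longrightarrow> in_hom B (\<alpha> a) (OMap F a) (OMap G a)"
    and naturality: "in_hom A f a b \<Longrightarrow> Comp B (\<alpha> b) (AMap F f) = Comp B (AMap G f) (\<alpha> a)"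

definition nt_id :: "('o, 'a) cat \<Rightarrow> ('p, 'b) cat \<Rightarrow> ('o, 'a, 'p, 'b) ftor \<Rightarrow> 'o \<Rightarrow> 'b" where
  "nt_id A B F = (\<lambda>a\<in>Obj A. Ident B (OMap F a))"

definition nt_vcomp :: "('o, 'a) cat \<Rightarrow> ('p, 'b) cat \<Rightarrow> ('o \<Rightarrow> 'b) \<Rightarrow> ('o \<Rightarrow> 'b) \<Rightarrow> 'o \<Rightarrow> 'b" where
  "nt_vcomp A B \<beta> \<alpha> = (\<lambda>a\<in>Obj A. Comp B (\<beta> a) (\<alpha> a))"

text \<open>Horizontal composite of \<open>\<alpha> : F \<Rightarrow> F' : A \<rightarrow> B\<close> and \<open>\<beta> : G \<Rightarrow> G' : B \<rightarrow> C\<close>,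
  with components \<open>\<beta>(F' a) \<circ> G(\<alpha> a)\<close>.\<close>

definition nt_hcomp :: "('o, 'a) cat \<Rightarrow> ('q, 'c) cat \<Rightarrow> ('p, 'b, 'q, 'c) ftor \<Rightarrow>
    ('o, 'a, 'p, 'b) ftor \<Rightarrow> ('p \<Rightarrow> 'c) \<Rightarrow> ('o \<Rightarrow> 'b) \<Rightarrow> 'o \<Rightarrow> 'c" where
  "nt_hcomp A C G F' \<beta> \<alpha> = (\<lambda>a\<in>Obj A. Comp C (\<beta> (OMap F' a)) (AMap G (\<alpha> a)))"

definition prod_cat :: "('o, 'a) cat \<Rightarrow> ('p, 'b) cat \<Rightarrow> ('o \<times> 'p, 'a \<times> 'b) cat" where
  "prod_cat A B = mk_cat (Obj A \<times> Obj B) (Arr A \<times> Arr B)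
     (map_prod (Dom A) (Dom B)) (map_prod (Cod A) (Cod B)) (map_prod (Ident A) (Ident B))
     (\<lambda>(g, g') (f, f'). (Comp A g f, Comp B g' f'))"


section \<open>The arrow category and pullbacks\<close>

text \<open>
  \<open>Square f u v g\<close> is the square with top \<open>u : dom f \<rightarrow> dom g\<close> and bottom \<open>v : cod f \<rightarrow> cod g\<close>,
  viewed as an arrow \<open>f \<rightarrow> g\<close> of the arrow category.
\<close>

datatype 'a square = Square (sq_left: 'a) (sq_top: 'a) (sq_bot: 'a) (sq_right: 'a)

definition squares :: "('o, 'a) cat \<Rightarrow> 'a square set" where
  "squares C = {s. sq_left s \<in> Arr C \<and> sq_right s \<in> Arr C
     \<and> in_hom C (sq_top s) (Dom C (sq_left s)) (Dom C (sq_right s))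
     \<and> in_hom C (sq_bot s) (Cod C (sq_left s)) (Cod C (sq_right s))
     \<and> Comp C (sq_right s) (sq_top s) = Comp C (sq_bot s) (sq_left s)}"

definition arrow_cat :: "('o, 'a) cat \<Rightarrow> ('a, 'a square) cat" where
  "arrow_cat C = mk_cat (Arr C) (squares C) sq_left sq_right
     (\<lambda>f. Square f (Ident C (Dom C f)) (Ident C (Cod C f)) f)
     (\<lambda>t s. Square (sq_left s) (Comp C (sq_top t) (sq_top s)) (Comp C (sq_bot t) (sq_bot s))
              (sq_right t))"

definition cod_functor :: "('o, 'a) cat \<Rightarrow> ('a, 'a square, 'o, 'a) ftor" where
  "cod_functor C = mk_ftor (arrow_cat C) (Cod C) sq_bot"

definition arrow_functor :: "('o, 'a) cat \<Rightarrow> ('o, 'a, 'p, 'b) ftor \<Rightarrow>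
    ('a, 'a square, 'b, 'b square) ftor" where
  "arrow_functor C F = mk_ftor (arrow_cat C) (AMap F) (map_square (AMap F))"

text \<open>The square exhibits \<open>sq_left s\<close> as a pullback of \<open>sq_right s\<close> along \<open>sq_bot s\<close>.\<close>

definition is_pullback :: "('o, 'a) cat \<Rightarrow> 'a square \<Rightarrow> bool" where
  "is_pullback C s \<longleftrightarrow> s \<in> squares C \<and>
     (\<forall>w x y. in_hom C x w (Dom C (sq_right s)) \<and> in_hom C y w (Cod C (sq_left s))
        \<and> Comp C (sq_right s) x = Comp C (sq_bot s) y \<longrightarrow>
        (\<exists>!z. in_hom C z w (Dom C (sq_left s)) \<and> Comp C (sq_top s) z = x
              \<and> Comp C (sq_left s) z = y))"


section \<open>Fibrations and comprehension categories\<close>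

definition cartesian :: "('s, 't) cat \<Rightarrow> ('o, 'a) cat \<Rightarrow> ('s, 't, 'o, 'a) ftor \<Rightarrow> 't \<Rightarrow> bool" where
  "cartesian T C p \<phi> \<longleftrightarrow> \<phi> \<in> Arr T \<and>
     (\<forall>\<psi> w. \<psi> \<in> Arr T \<and> Cod T \<psi> = Cod T \<phi>
        \<and> in_hom C w (OMap p (Dom T \<psi>)) (OMap p (Dom T \<phi>))
        \<and> Comp C (AMap p \<phi>) w = AMap p \<psi> \<longrightarrow>
        (\<exists>!\<theta>. in_hom T \<theta> (Dom T \<psi>) (Dom T \<phi>) \<and> Comp T \<phi> \<theta> = \<psi> \<and> AMap p \<theta> = w))"

locale fibration = cat_functor T C p
  for T :: "('s, 't) cat" and C :: "('o, 'a) cat" and p +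
  assumes cartesian_lift: "A \<in> Obj T \<Longrightarrow> f \<in> Arr C \<Longrightarrow> Cod C f = OMap p A \<Longrightarrow>
      \<exists>\<phi>. cartesian T C p \<phi> \<and> Cod T \<phi> = A \<and> AMap p \<phi> = f"

record ('o, 'a, 's, 't) compcat =
  Base :: "('o, 'a) cat"
  Total :: "('s, 't) cat"
  Proj :: "('s, 't, 'o, 'a) ftor"
  Compr :: "('s, 't, 'a, 'a square) ftor"

abbreviation cartesian_in :: "('o, 'a, 's, 't) compcat \<Rightarrow> 't \<Rightarrow> bool" where
  "cartesian_in K \<equiv> cartesian (Total K) (Base K) (Proj K)"

locale comprehension_category =
  fixes K :: "('o, 'a, 's, 't) compcat"
  assumes fibration: "fibration (Total K) (Base K) (Proj K)"
    and Compr_functor: "cat_functor (Total K) (arrow_cat (Base K)) (Compr K)"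
    and cod_Compr: "fcomp (Total K) (cod_functor (Base K)) (Compr K) = Proj K"
    and Compr_cartesian: "cartesian_in K \<phi> \<Longrightarrow> is_pullback (Base K) (AMap (Compr K) \<phi>)"

locale full_comprehension_category = comprehension_category +
  assumes Compr_full: "full_functor (Total K) (arrow_cat (Base K)) (Compr K)"
    and Compr_faithful: "faithful_functor (Total K) (Compr K)"

text \<open>
  The total category is literally a full subcategory of the arrow category of the base: its
  objects are arrows of the base, its arrows are squares, and the comprehension functor is the
  inclusion (so in particular injective on objects).
\<close>

locale subcategorical_comprehension_category = full_comprehension_category K
  for K :: "('o, 'a, 'a, 'a square) compcat" +
  assumes Compr_obj: "A \<in> Obj (Total K) \<Longrightarrow> OMap (Compr K) A = A"
    and Compr_arr: "\<phi> \<in> Arr (Total K) \<Longrightarrow> AMap (Compr K) \<phi> = \<phi>"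

record ('o, 'a, 's, 't, 'p, 'b, 'u, 'v) ccmap =
  MBase :: "('o, 'a, 'p, 'b) ftor"
  MTotal :: "('s, 't, 'u, 'v) ftor"

locale strict_map = K: comprehension_category K + K': comprehension_category K'
  for K :: "('o, 'a, 's, 't) compcat" and K' :: "('p, 'b, 'u, 'v) compcat" +
  fixes M :: "('o, 'a, 's, 't, 'p, 'b, 'u, 'v) ccmap"
  assumes MBase_functor: "cat_functor (Base K) (Base K') (MBase M)"
    and MTotal_functor: "cat_functor (Total K) (Total K') (MTotal M)"
    and MTotal_over: "fcomp (Total K) (Proj K') (MTotal M) = fcomp (Total K) (MBase M) (Proj K)"
    and MTotal_cartesian: "cartesian_in K \<phi> \<Longrightarrow> cartesian_in K' (AMap (MTotal M) \<phi>)"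
    and MTotal_Compr: "fcomp (Total K) (Compr K') (MTotal M) =
          fcomp (Total K) (arrow_functor (Base K) (MBase M)) (Compr K)"

record ('o, 'b, 's, 'v) cctrans =
  TBase :: "'o \<Rightarrow> 'b"
  TTotal :: "'s \<Rightarrow> 'v"

locale transformation = M: strict_map K K' M + N: strict_map K K' N
  for K :: "('o, 'a, 's, 't) compcat" and K' :: "('p, 'b, 'u, 'v) compcat" and M N +
  fixes \<tau> :: "('o, 'b, 's, 'v) cctrans"
  assumes TBase_nat: "nat_trans (Base K) (Base K') (MBase M) (MBase N) (TBase \<tau>)"
    and TTotal_nat: "nat_trans (Total K) (Total K') (MTotal M) (MTotal N) (TTotal \<tau>)"
    and TTotal_over: "A \<in> Obj (Total K) \<Longrightarrow>
          AMap (Proj K') (TTotal \<tau> A) = TBase \<tau> (OMap (Proj K) A)"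
    and TTotal_Compr: "A \<in> Obj (Total K) \<Longrightarrow>
          sq_top (AMap (Compr K') (TTotal \<tau> A)) = TBase \<tau> (Dom (Base K) (OMap (Compr K) A))"


section \<open>Strict 2-categories\<close>

text \<open>
  A 2-category in the Cat-enriched presentation: \<open>HComp X A B C\<close> is the composition functor from
  \<open>HomCat X B C \<times> HomCat X A B\<close> to \<open>HomCat X A C\<close>.
\<close>

record ('x, 'f, 'd) twocat =
  Cells0 :: "'x set"
  HomCat :: "'x \<Rightarrow> 'x \<Rightarrow> ('f, 'd) cat"
  Unit1 :: "'x \<Rightarrow> 'f"
  HComp :: "'x \<Rightarrow> 'x \<Rightarrow> 'x \<Rightarrow> ('f \<times> 'f, 'd \<times> 'd, 'f, 'd) ftor"

locale two_category =
  fixes X :: "('x, 'f, 'd) twocat"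
  assumes HomCat_category: "A \<in> Cells0 X \<Longrightarrow> B \<in> Cells0 X \<Longrightarrow> category (HomCat X A B)"
    and Unit1_cell: "A \<in> Cells0 X \<Longrightarrow> Unit1 X A \<in> Obj (HomCat X A A)"
    and HComp_functor: "A \<in> Cells0 X \<Longrightarrow> B \<in> Cells0 X \<Longrightarrow> C \<in> Cells0 X \<Longrightarrow>
          cat_functor (prod_cat (HomCat X B C) (HomCat X A B)) (HomCat X A C) (HComp X A B C)"
    and unit_right1: "A \<in> Cells0 X \<Longrightarrow> B \<in> Cells0 X \<Longrightarrow> f \<in> Obj (HomCat X A B) \<Longrightarrow>
          OMap (HComp X A A B) (f, Unit1 X A) = f"
    and unit_left1: "A \<in> Cells0 X \<Longrightarrow> B \<in> Cells0 X \<Longrightarrow> f \<in> Obj (HomCat X A B) \<Longrightarrow>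
          OMap (HComp X A B B) (Unit1 X B, f) = f"
    and unit_right2: "A \<in> Cells0 X \<Longrightarrow> B \<in> Cells0 X \<Longrightarrow> \<sigma> \<in> Arr (HomCat X A B) \<Longrightarrow>
          AMap (HComp X A A B) (\<sigma>, Ident (HomCat X A A) (Unit1 X A)) = \<sigma>"
    and unit_left2: "A \<in> Cells0 X \<Longrightarrow> B \<in> Cells0 X \<Longrightarrow> \<sigma> \<in> Arr (HomCat X A B) \<Longrightarrow>
          AMap (HComp X A B B) (Ident (HomCat X B B) (Unit1 X B), \<sigma>) = \<sigma>"
    and assoc1: "A \<in> Cells0 X \<Longrightarrow> B \<in> Cells0 X \<Longrightarrow> C \<in> Cells0 X \<Longrightarrow> D \<in> Cells0 X \<Longrightarrow>
          f \<in> Obj (HomCat X A B) \<Longrightarrow> g \<in> Obj (HomCat X B C) \<Longrightarrow> h \<in> Obj (HomCat X C D) \<Longrightarrow>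
          OMap (HComp X A C D) (h, OMap (HComp X A B C) (g, f)) =
          OMap (HComp X A B D) (OMap (HComp X B C D) (h, g), f)"
    and assoc2: "A \<in> Cells0 X \<Longrightarrow> B \<in> Cells0 X \<Longrightarrow> C \<in> Cells0 X \<Longrightarrow> D \<in> Cells0 X \<Longrightarrow>
          \<rho> \<in> Arr (HomCat X A B) \<Longrightarrow> \<sigma> \<in> Arr (HomCat X B C) \<Longrightarrow> \<tau> \<in> Arr (HomCat X C D) \<Longrightarrow>
          AMap (HComp X A C D) (\<tau>, AMap (HComp X A B C) (\<sigma>, \<rho>)) =
          AMap (HComp X A B D) (AMap (HComp X B C D) (\<tau>, \<sigma>), \<rho>)"

record ('x, 'f, 'd, 'y, 'g, 'e) twoftor =
  F0 :: "'x \<Rightarrow> 'y"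
  FHom :: "'x \<Rightarrow> 'x \<Rightarrow> ('f, 'd, 'g, 'e) ftor"

locale two_functor = X: two_category X + Y: two_category Y
  for X :: "('x, 'f, 'd) twocat" and Y :: "('y, 'g, 'e) twocat" +
  fixes \<Phi> :: "('x, 'f, 'd, 'y, 'g, 'e) twoftor"
  assumes F0_cell: "A \<in> Cells0 X \<Longrightarrow> F0 \<Phi> A \<in> Cells0 Y"
    and FHom_functor: "A \<in> Cells0 X \<Longrightarrow> B \<in> Cells0 X \<Longrightarrow>
          cat_functor (HomCat X A B) (HomCat Y (F0 \<Phi> A) (F0 \<Phi> B)) (FHom \<Phi> A B)"
    and FHom_Unit1: "A \<in> Cells0 X \<Longrightarrow> OMap (FHom \<Phi> A A) (Unit1 X A) = Unit1 Y (F0 \<Phi> A)"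
    and FHom_comp1: "A \<in> Cells0 X \<Longrightarrow> B \<in> Cells0 X \<Longrightarrow> C \<in> Cells0 X \<Longrightarrow>
          f \<in> Obj (HomCat X A B) \<Longrightarrow> g \<in> Obj (HomCat X B C) \<Longrightarrow>
          OMap (FHom \<Phi> A C) (OMap (HComp X A B C) (g, f)) =
          OMap (HComp Y (F0 \<Phi> A) (F0 \<Phi> B) (F0 \<Phi> C)) (OMap (FHom \<Phi> B C) g, OMap (FHom \<Phi> A B) f)"
    and FHom_comp2: "A \<in> Cells0 X \<Longrightarrow> B \<in> Cells0 X \<Longrightarrow> C \<in> Cells0 X \<Longrightarrow>
          \<sigma> \<in> Arr (HomCat X A B) \<Longrightarrow> \<tau> \<in> Arr (HomCat X B C) \<Longrightarrow>
          AMap (FHom \<Phi> A C) (AMap (HComp X A B C) (\<tau>, \<sigma>)) =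
          AMap (HComp Y (F0 \<Phi> A) (F0 \<Phi> B) (F0 \<Phi> C)) (AMap (FHom \<Phi> B C) \<tau>, AMap (FHom \<Phi> A B) \<sigma>)"

text \<open>\<open>\<Psi>\<close> after \<open>\<Phi>\<close> is the identity on 0-cells, 1-cells and 2-cells of \<open>X\<close>.\<close>

definition two_functor_left_inverse :: "('x, 'f, 'd) twocat \<Rightarrow> ('y, 'g, 'e, 'x, 'f, 'd) twoftor \<Rightarrow>
    ('x, 'f, 'd, 'y, 'g, 'e) twoftor \<Rightarrow> bool" where
  "two_functor_left_inverse X \<Psi> \<Phi> \<longleftrightarrow>
     (\<forall>A\<in>Cells0 X. F0 \<Psi> (F0 \<Phi> A) = A) \<and>
     (\<forall>A\<in>Cells0 X. \<forall>B\<in>Cells0 X.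
        fcomp (HomCat X A B) (FHom \<Psi> (F0 \<Phi> A) (F0 \<Phi> B)) (FHom \<Phi> A B) = fid (HomCat X A B))"

definition isomorphic_two_categories :: "('x, 'f, 'd) twocat \<Rightarrow> ('y, 'g, 'e) twocat \<Rightarrow> bool" where
  "isomorphic_two_categories X Y \<longleftrightarrow>
     (\<exists>\<Phi> \<Psi>. two_functor X Y \<Phi> \<and> two_functor Y X \<Psi>
        \<and> two_functor_left_inverse X \<Psi> \<Phi> \<and> two_functor_left_inverse Y \<Phi> \<Psi>)"

definition full_sub_two_category :: "('x, 'f, 'd) twocat \<Rightarrow> ('x \<Rightarrow> bool) \<Rightarrow> ('x, 'f, 'd) twocat" where
  "full_sub_two_category X P = X \<lparr> Cells0 := {A \<in> Cells0 X. P A} \<rparr>"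

text \<open>A family of components does not determine the 1-cells it runs between, so a 2-cell is
  tagged with them.\<close>

datatype ('f, 'n) cell2 = Cell2 (src2: 'f) (body2: 'n) (trg2: 'f)


section \<open>Structured display map categories\<close>

record ('o, 'a) dmc =
  Under :: "('o, 'a) cat"
  Disp :: "'a set"

locale display_map_category =
  fixes D :: "('o, 'a) dmc"
  assumes Under_category: "category (Under D)"
    and Disp_arr: "Disp D \<subseteq> Arr (Under D)"
    and Disp_pullback: "d \<in> Disp D \<Longrightarrow> f \<in> Arr (Under D) \<Longrightarrow> Cod (Under D) f = Cod (Under D) d \<Longrightarrow>
          \<exists>s. is_pullback (Under D) s \<and> sq_right s = d \<and> sq_bot s = f \<and> sq_left s \<in> Disp D"

locale dmc_map = D: display_map_category D + D': display_map_category D'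
  for D :: "('o, 'a) dmc" and D' :: "('p, 'b) dmc" +
  fixes F :: "('o, 'a, 'p, 'b) ftor"
  assumes map_functor: "cat_functor (Under D) (Under D') F"
    and map_Disp: "d \<in> Disp D \<Longrightarrow> AMap F d \<in> Disp D'"
    and map_pullback: "is_pullback (Under D) s \<Longrightarrow> sq_right s \<in> Disp D \<Longrightarrow>
          is_pullback (Under D') (map_square (AMap F) s)"

definition dmc_hom :: "('o, 'a) dmc \<Rightarrow> ('p, 'b) dmc \<Rightarrow>
    (('o, 'a, 'p, 'b) ftor, (('o, 'a, 'p, 'b) ftor, 'o \<Rightarrow> 'b) cell2) cat" where
  "dmc_hom D D' = mk_cat {F. dmc_map D D' F}
     {\<sigma>. dmc_map D D' (src2 \<sigma>) \<and> dmc_map D D' (trg2 \<sigma>)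
         \<and> nat_trans (Under D) (Under D') (src2 \<sigma>) (trg2 \<sigma>) (body2 \<sigma>)}
     src2 trg2
     (\<lambda>F. Cell2 F (nt_id (Under D) (Under D') F) F)
     (\<lambda>\<tau> \<sigma>. Cell2 (src2 \<sigma>) (nt_vcomp (Under D) (Under D') (body2 \<tau>) (body2 \<sigma>)) (trg2 \<tau>))"

text \<open>
  Size: the 0-cells range over all structures whose base category has its objects in the type
  \<open>'o\<close> and its arrows in the type \<open>'a\<close>. Both types are arbitrary.
\<close>

type_synonym ('o, 'a) sDMC_twocat =
  "(('o, 'a) dmc, ('o, 'a, 'o, 'a) ftor, (('o, 'a, 'o, 'a) ftor, 'o \<Rightarrow> 'a) cell2) twocat"

definition sDMC :: "('o, 'a) sDMC_twocat" where
  "sDMC =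
     \<lparr> Cells0 = {D. display_map_category D},
       HomCat = dmc_hom,
       Unit1 = (\<lambda>D. fid (Under D)),
       HComp = (\<lambda>D D' D''. mk_ftor (prod_cat (dmc_hom D' D'') (dmc_hom D D'))
         (\<lambda>(G, F). fcomp (Under D) G F)
         (\<lambda>(\<tau>, \<sigma>). Cell2 (fcomp (Under D) (src2 \<tau>) (src2 \<sigma>))
            (nt_hcomp (Under D) (Under D'') (src2 \<tau>) (trg2 \<sigma>) (body2 \<tau>) (body2 \<sigma>))
            (fcomp (Under D) (trg2 \<tau>) (trg2 \<sigma>)))) \<rparr>"


section \<open>The 2-category of comprehension categories\<close>

definition ccmap_id :: "('o, 'a, 's, 't) compcat \<Rightarrow> ('o, 'a, 's, 't, 'o, 'a, 's, 't) ccmap" where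
  "ccmap_id K = \<lparr> MBase = fid (Base K), MTotal = fid (Total K) \<rparr>"

definition ccmap_comp :: "('o, 'a, 's, 't) compcat \<Rightarrow>
    ('p, 'b, 'u, 'v, 'q, 'c, 'w, 'z) ccmap \<Rightarrow> ('o, 'a, 's, 't, 'p, 'b, 'u, 'v) ccmap \<Rightarrow>
    ('o, 'a, 's, 't, 'q, 'c, 'w, 'z) ccmap" where
  "ccmap_comp K N M =
     \<lparr> MBase = fcomp (Base K) (MBase N) (MBase M),
       MTotal = fcomp (Total K) (MTotal N) (MTotal M) \<rparr>"

definition cctrans_id :: "('o, 'a, 's, 't) compcat \<Rightarrow> ('p, 'b, 'u, 'v) compcat \<Rightarrow>
    ('o, 'a, 's, 't, 'p, 'b, 'u, 'v) ccmap \<Rightarrow> ('o, 'b, 's, 'v) cctrans" where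
  "cctrans_id K K' M =
     \<lparr> TBase = nt_id (Base K) (Base K') (MBase M),
       TTotal = nt_id (Total K) (Total K') (MTotal M) \<rparr>"

definition cctrans_vcomp :: "('o, 'a, 's, 't) compcat \<Rightarrow> ('p, 'b, 'u, 'v) compcat \<Rightarrow>
    ('o, 'b, 's, 'v) cctrans \<Rightarrow> ('o, 'b, 's, 'v) cctrans \<Rightarrow> ('o, 'b, 's, 'v) cctrans" where
  "cctrans_vcomp K K' \<tau> \<sigma> =
     \<lparr> TBase = nt_vcomp (Base K) (Base K') (TBase \<tau>) (TBase \<sigma>),
       TTotal = nt_vcomp (Total K) (Total K') (TTotal \<tau>) (TTotal \<sigma>) \<rparr>"

definition cctrans_hcomp :: "('o, 'a, 's, 't) compcat \<Rightarrow> ('q, 'c, 'w, 'z) compcat \<Rightarrow>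
    ('p, 'b, 'u, 'v, 'q, 'c, 'w, 'z) ccmap \<Rightarrow> ('o, 'a, 's, 't, 'p, 'b, 'u, 'v) ccmap \<Rightarrow>
    ('p, 'c, 'u, 'z) cctrans \<Rightarrow> ('o, 'b, 's, 'v) cctrans \<Rightarrow> ('o, 'c, 's, 'z) cctrans" where
  "cctrans_hcomp K K'' N M' \<tau> \<sigma> =
     \<lparr> TBase = nt_hcomp (Base K) (Base K'') (MBase N) (MBase M') (TBase \<tau>) (TBase \<sigma>),
       TTotal = nt_hcomp (Total K) (Total K'') (MTotal N) (MTotal M') (TTotal \<tau>) (TTotal \<sigma>) \<rparr>"

definition compcat_hom :: "('o, 'a, 's, 't) compcat \<Rightarrow> ('p, 'b, 'u, 'v) compcat \<Rightarrow>
    (('o, 'a, 's, 't, 'p, 'b, 'u, 'v) ccmap,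
     (('o, 'a, 's, 't, 'p, 'b, 'u, 'v) ccmap, ('o, 'b, 's, 'v) cctrans) cell2) cat" where
  "compcat_hom K K' = mk_cat {M. strict_map K K' M}
     {\<sigma>. transformation K K' (src2 \<sigma>) (trg2 \<sigma>) (body2 \<sigma>)}
     src2 trg2
     (\<lambda>M. Cell2 M (cctrans_id K K' M) M)
     (\<lambda>\<tau> \<sigma>. Cell2 (src2 \<sigma>) (cctrans_vcomp K K' (body2 \<tau>) (body2 \<sigma>)) (trg2 \<tau>))"

type_synonym ('o, 'a, 's, 't) CompCat_twocat =
  "(('o, 'a, 's, 't) compcat, ('o, 'a, 's, 't, 'o, 'a, 's, 't) ccmap,
    (('o, 'a, 's, 't, 'o, 'a, 's, 't) ccmap, ('o, 'a, 's, 't) cctrans) cell2) twocat"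

definition CompCat_str :: "('o, 'a, 's, 't) CompCat_twocat" where
  "CompCat_str =
     \<lparr> Cells0 = {K. comprehension_category K},
       HomCat = compcat_hom,
       Unit1 = ccmap_id,
       HComp = (\<lambda>K K' K''. mk_ftor (prod_cat (compcat_hom K' K'') (compcat_hom K K'))
         (\<lambda>(N, M). ccmap_comp K N M)
         (\<lambda>(\<tau>, \<sigma>). Cell2 (ccmap_comp K (src2 \<tau>) (src2 \<sigma>))
            (cctrans_hcomp K K'' (src2 \<tau>) (trg2 \<sigma>) (body2 \<tau>) (body2 \<sigma>))
            (ccmap_comp K (trg2 \<tau>) (trg2 \<sigma>)))) \<rparr>"

definition CompCat_str_sub :: "('o, 'a, 'a, 'a square) CompCat_twocat" where
  "CompCat_str_sub = full_sub_two_category CompCat_str subcategorical_comprehension_category"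

end

theory Submission
  imports Defs
begin

text \<open>
  A category of display maps yields the full subcategory of the arrow category on the display maps.
  Over the codomain functor its cartesian arrows are exactly its pullback squares, since cartesian
  lifts are unique up to isomorphism and one lift is a pullback by assumption; so it is a
  subcategorical comprehension category. Conversely the base and the set of objects of the total
  category determine a subcategorical comprehension category, the base functor determines a strict
  map (because both comprehension functors are inclusions), and the base
  component determines a transformation (its bottom edge is fixed by \<open>p'\<close>, its top edge by the
  domain condition). Hence the 2-functor that forgets the total parts is bijective on cells of each
  dimension.
\<close>

section \<open>Categories and functors\<close>

text \<open>Display maps are not closed under isomorphism, and the two sides quantify over different
  pullback squares. A cartesian arrow of the total category has both its left and its right edge
  among the display maps, whereas \<open>dmc_map\<close> asks for preservation of every pullback
  square whose right edge is a display map, wherever its left edge lies. The bridge is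
  \<open>square_isomorphism\<close>: two pullbacks of one cospan differ by an invertible change of
  apex, functors preserve such a change, and being a pullback is invariant under it. The isomorphism
  is strict, so every comparison must end in HOL equality. Categories and functors are therefore
  built with \<open>mk_cat\<close> and \<open>mk_ftor\<close>, which put \<open>undefined\<close>
  outside the carriers, so that agreement on carriers yields equality. Compatibility of the inverse
  2-functor with units and composition is not computed from explicit formulas; it follows from
  bijectivity of the forgetful one.\<close>

lemma in_homD:
  assumes "in_hom C f a b"
  shows "f \<in> Arr C" "Dom C f = a" "Cod C f = b"
  using assms by (auto simp: in_hom_def)

context category
begin

lemma Dom_obj: "f \<in> Arr C \<Longrightarrow> Dom C f \<in> Obj C"
  using Dom_ext by (auto simp: PiE_def)

lemma Cod_obj: "f \<in> Arr C \<Longrightarrow> Cod C f \<in> Obj C"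
  using Cod_ext by (auto simp: PiE_def)

lemma in_hom_obj:
  assumes "in_hom C f a b"
  shows "a \<in> Obj C" "b \<in> Obj C"
  using assms Dom_obj Cod_obj by (auto simp: in_hom_def)

lemma Comp_cancel_inverse:
  assumes "in_hom C k a b" "in_hom C l b a" "Comp C k l = Ident C b" "in_hom C z c b"
  shows "Comp C k (Comp C l z) = z"
  using assms Comp_assoc Comp_Ident_left by metis

end

lemma mk_cat_simps [simp]:
  "Obj (mk_cat Ob Ar d c i m) = Ob"
  "Arr (mk_cat Ob Ar d c i m) = Ar"
  "f \<in> Ar \<Longrightarrow> Dom (mk_cat Ob Ar d c i m) f = d f"
  "f \<in> Ar \<Longrightarrow> Cod (mk_cat Ob Ar d c i m) f = c f"
  "a \<in> Ob \<Longrightarrow> Ident (mk_cat Ob Ar d c i m) a = i a"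
  "f \<in> Ar \<Longrightarrow> g \<in> Ar \<Longrightarrow> d g = c f \<Longrightarrow> Comp (mk_cat Ob Ar d c i m) g f = m g f"
  "in_hom (mk_cat Ob Ar d c i m) f a b \<longleftrightarrow> f \<in> Ar \<and> d f = a \<and> c f = b"
  by (auto simp: mk_cat_def in_hom_def)

text \<open>The raw operations satisfy the laws on the carriers; the restriction built into
  \<open>mk_cat\<close> supplies the extensionality axioms of \<open>category\<close>.\<close>

lemma category_mk_cat:
  assumes "\<And>f. f \<in> Ar \<Longrightarrow> d f \<in> Ob" "\<And>f. f \<in> Ar \<Longrightarrow> c f \<in> Ob"
    and "\<And>a. a \<in> Ob \<Longrightarrow> i a \<in> Ar \<and> d (i a) = a \<and> c (i a) = a"
    and "\<And>f g. f \<in> Ar \<Longrightarrow> g \<in> Ar \<Longrightarrow> d g = c f \<Longrightarrow>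
           m g f \<in> Ar \<and> d (m g f) = d f \<and> c (m g f) = c g"
    and "\<And>f. f \<in> Ar \<Longrightarrow> m f (i (d f)) = f" "\<And>f. f \<in> Ar \<Longrightarrow> m (i (c f)) f = f"
    and "\<And>f g h. f \<in> Ar \<Longrightarrow> g \<in> Ar \<Longrightarrow> h \<in> Ar \<Longrightarrow> d g = c f \<Longrightarrow> d h = c g \<Longrightarrow>
           m h (m g f) = m (m h g) f"
  shows "category (mk_cat Ob Ar d c i m)"
proof
  show "Dom (mk_cat Ob Ar d c i m) \<in> Arr (mk_cat Ob Ar d c i m) \<rightarrow>\<^sub>E Obj (mk_cat Ob Ar d c i m)"
    "Cod (mk_cat Ob Ar d c i m) \<in> Arr (mk_cat Ob Ar d c i m) \<rightarrow>\<^sub>E Obj (mk_cat Ob Ar d c i m)"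
    "Ident (mk_cat Ob Ar d c i m) \<in> extensional (Obj (mk_cat Ob Ar d c i m))"
    using assms(1,2) by (auto simp: mk_cat_def)
  show "Comp (mk_cat Ob Ar d c i m) g f = undefined"
    if "\<not> (f \<in> Arr (mk_cat Ob Ar d c i m) \<and> g \<in> Arr (mk_cat Ob Ar d c i m)
           \<and> Dom (mk_cat Ob Ar d c i m) g = Cod (mk_cat Ob Ar d c i m) f)" for f g
    using that by (auto simp: mk_cat_def)
qed (use assms in auto)

lemma prod_cat_simps [simp]:
  assumes "category A" "category B"
  shows "Obj (prod_cat A B) = Obj A \<times> Obj B"
    "Arr (prod_cat A B) = Arr A \<times> Arr B"
    "in_hom (prod_cat A B) (f, g) (a, b) (a', b') \<longleftrightarrow> in_hom A f a a' \<and> in_hom B g b b'"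
    "a \<in> Obj A \<Longrightarrow> b \<in> Obj B \<Longrightarrow> Ident (prod_cat A B) (a, b) = (Ident A a, Ident B b)"
    "in_hom A f a a' \<Longrightarrow> in_hom A f' a' a'' \<Longrightarrow> in_hom B g b b' \<Longrightarrow> in_hom B g' b' b'' \<Longrightarrow>
      Comp (prod_cat A B) (f', g') (f, g) = (Comp A f' f, Comp B g' g)"
  by (auto simp: prod_cat_def in_hom_def)

lemma category_prod_cat:
  assumes "category A" "category B"
  shows "category (prod_cat A B)"
proof -
  interpret A: category A by fact
  interpret B: category B by fact
  note h = A.Ident_in_hom B.Ident_in_hom A.Comp_in_hom B.Comp_in_hom A.Comp_Ident_left
    B.Comp_Ident_left A.Comp_Ident_right B.Comp_Ident_right A.Comp_assoc B.Comp_assoc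
  show ?thesis
    unfolding prod_cat_def
    by (rule category_mk_cat) (use h in \<open>auto simp: in_hom_def A.Dom_obj B.Dom_obj A.Cod_obj B.Cod_obj\<close>)
qed

section \<open>Functors, their composition and strict equality\<close>

context cat_functor
begin

lemma OMap_obj: "a \<in> Obj A \<Longrightarrow> OMap F a \<in> Obj B"
  using OMap_ext by (auto simp: PiE_def)

lemma AMap_arr:
  assumes "f \<in> Arr A"
  shows "AMap F f \<in> Arr B" "Dom B (AMap F f) = OMap F (Dom A f)" "Cod B (AMap F f) = OMap F (Cod A f)"
  using AMap_in_hom[of f "Dom A f" "Cod A f"] assms by (auto simp: in_hom_def)

end

lemma mk_ftor_simps [simp]:
  "a \<in> Obj A \<Longrightarrow> OMap (mk_ftor A ob ar) a = ob a"
  "f \<in> Arr A \<Longrightarrow> AMap (mk_ftor A ob ar) f = ar f"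
  by (auto simp: mk_ftor_def)

lemma cat_functor_mk_ftor:
  assumes "category A" "category B"
    and "\<And>a. a \<in> Obj A \<Longrightarrow> ob a \<in> Obj B"
    and "\<And>f a b. in_hom A f a b \<Longrightarrow> in_hom B (ar f) (ob a) (ob b)"
    and "\<And>a. a \<in> Obj A \<Longrightarrow> ar (Ident A a) = Ident B (ob a)"
    and "\<And>f g a b c. in_hom A f a b \<Longrightarrow> in_hom A g b c \<Longrightarrow> ar (Comp A g f) = Comp B (ar g) (ar f)"
  shows "cat_functor A B (mk_ftor A ob ar)"
proof -
  interpret A: category A by fact
  interpret B: category B by fact
  have arr: "AMap (mk_ftor A ob ar) f = ar f" "OMap (mk_ftor A ob ar) a = ob a"
    "OMap (mk_ftor A ob ar) b = ob b" if "in_hom A f a b" for f a b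
    using that A.in_hom_obj[OF that] by (auto simp: in_hom_def)
  show ?thesis
  proof
    show "OMap (mk_ftor A ob ar) \<in> Obj A \<rightarrow>\<^sub>E Obj B" "AMap (mk_ftor A ob ar) \<in> extensional (Arr A)"
      using assms(3) by (auto simp: mk_ftor_def)
    show "in_hom B (AMap (mk_ftor A ob ar) f) (OMap (mk_ftor A ob ar) a) (OMap (mk_ftor A ob ar) b)"
      if "in_hom A f a b" for f a b
      using that assms(4) by (simp add: arr[OF that])
    show "AMap (mk_ftor A ob ar) (Ident A a) = Ident B (OMap (mk_ftor A ob ar) a)" if "a \<in> Obj A" for a
      using that assms(5) arr(1)[OF A.Ident_in_hom[OF that]] by simp
    show "AMap (mk_ftor A ob ar) (Comp A g f) = Comp B (AMap (mk_ftor A ob ar) g) (AMap (mk_ftor A ob ar) f)"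
      if "in_hom A f a b" "in_hom A g b c" for f g a b c
      using assms(6)[OF that] by (simp add: arr[OF that(1)] arr[OF that(2)] arr[OF A.Comp_in_hom[OF that]])
  qed
qed

lemma mk_ftor_eq_iff:
  "mk_ftor A ob ar = mk_ftor A ob' ar' \<longleftrightarrow> (\<forall>a\<in>Obj A. ob a = ob' a) \<and> (\<forall>f\<in>Arr A. ar f = ar' f)"
  by (auto simp: mk_ftor_def fun_eq_iff restrict_def)

text \<open>A functor is extensional, hence equal to its own restriction. Rewriting one side of an
  equation with this turns strict equality of functors into the pointwise condition of
  \<open>mk_ftor_eq_iff\<close>.\<close>

lemma cat_functor_eq_mk_ftor: "cat_functor A B F \<Longrightarrow> F = mk_ftor A (OMap F) (AMap F)"
  unfolding mk_ftor_def
  by (auto simp: cat_functor_def cat_functor_axioms_def PiE_def extensional_restrict)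

lemma fid_simps [simp]:
  "a \<in> Obj A \<Longrightarrow> OMap (fid A) a = a" "f \<in> Arr A \<Longrightarrow> AMap (fid A) f = f"
  by (simp_all add: fid_def)

lemma fcomp_simps [simp]:
  "a \<in> Obj A \<Longrightarrow> OMap (fcomp A G F) a = OMap G (OMap F a)"
  "f \<in> Arr A \<Longrightarrow> AMap (fcomp A G F) f = AMap G (AMap F f)"
  by (simp_all add: fcomp_def)

lemma cat_functor_fid: "category A \<Longrightarrow> cat_functor A A (fid A)"
  unfolding fid_def by (rule cat_functor_mk_ftor) auto

lemma cat_functor_fcomp:
  assumes "cat_functor A B F" "cat_functor B C G"
  shows "cat_functor A C (fcomp A G F)"
proof -
  interpret F: cat_functor A B F by fact
  interpret G: cat_functor B C G by fact
  show ?thesis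
    unfolding fcomp_def
  proof (rule cat_functor_mk_ftor)
    show "(AMap G \<circ> AMap F) (Comp A g f) = Comp C ((AMap G \<circ> AMap F) g) ((AMap G \<circ> AMap F) f)"
      if "in_hom A f a b" "in_hom A g b c" for f g a b c
      using that by (simp add: F.AMap_Comp[OF that] G.AMap_Comp[OF F.AMap_in_hom F.AMap_in_hom, of f a b g c])
  qed (auto simp: F.OMap_obj G.OMap_obj F.AMap_Ident G.AMap_Ident
      intro: F.A.category_axioms G.B.category_axioms F.AMap_in_hom G.AMap_in_hom)
qed

lemma fcomp_fid_right: "cat_functor A B F \<Longrightarrow> fcomp A F (fid A) = F"
  by (subst (2) cat_functor_eq_mk_ftor) (auto simp: fcomp_def mk_ftor_eq_iff)

lemma fcomp_fid_left:
  assumes "cat_functor A B F"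
  shows "fcomp A (fid B) F = F"
proof -
  interpret cat_functor A B F by fact
  show ?thesis
    by (subst (2) cat_functor_eq_mk_ftor[OF assms])
      (auto simp: fcomp_def mk_ftor_eq_iff OMap_obj AMap_arr)
qed

text \<open>\<open>fcomp B H G\<close> is restricted to the carriers of \<open>B\<close>; since
  \<open>F\<close> lands there, the restriction is invisible after precomposition with
  \<open>F\<close>.\<close>

lemma fcomp_assoc:
  assumes "cat_functor A B F"
  shows "fcomp A H (fcomp A G F) = fcomp A (fcomp B H G) F"
proof -
  interpret cat_functor A B F by fact
  show ?thesis
    by (auto simp: fcomp_def[of A] mk_ftor_eq_iff OMap_obj AMap_arr)
qed

lemma fcomp_apply:
  assumes "fcomp A G F = fcomp A G' F'"
  shows "a \<in> Obj A \<Longrightarrow> OMap G (OMap F a) = OMap G' (OMap F' a)"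
    and "f \<in> Arr A \<Longrightarrow> AMap G (AMap F f) = AMap G' (AMap F' f)"
  using assms by (simp_all add: fcomp_def mk_ftor_eq_iff)


section \<open>Natural transformations\<close>

context nat_trans
begin

lemma component_arr:
  assumes "a \<in> Obj A"
  shows "\<alpha> a \<in> Arr B" "Dom B (\<alpha> a) = OMap F a" "Cod B (\<alpha> a) = OMap G a"
  using component_in_hom[OF assms] by (auto simp: in_hom_def)

end

lemma nat_trans_restrictI:
  assumes "cat_functor A B F" "cat_functor A B G"
    and "\<And>a. a \<in> Obj A \<Longrightarrow> in_hom B (\<alpha> a) (OMap F a) (OMap G a)"
    and "\<And>f a b. in_hom A f a b \<Longrightarrow> Comp B (\<alpha> b) (AMap F f) = Comp B (AMap G f) (\<alpha> a)"
  shows "nat_trans A B F G (restrict \<alpha> (Obj A))"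
proof -
  interpret F: cat_functor A B F by fact
  interpret G: cat_functor A B G by fact
  show ?thesis
    by unfold_locales (auto simp: assms(3,4) dest: F.A.in_hom_obj)
qed

lemma nt_simps [simp]:
  "a \<in> Obj A \<Longrightarrow> nt_id A B F a = Ident B (OMap F a)"
  "a \<in> Obj A \<Longrightarrow> nt_vcomp A B \<beta> \<alpha> a = Comp B (\<beta> a) (\<alpha> a)"
  "a \<in> Obj A \<Longrightarrow> nt_hcomp A C G F' \<gamma> \<alpha>' a = Comp C (\<gamma> (OMap F' a)) (AMap G (\<alpha>' a))"
  by (simp_all add: nt_id_def nt_vcomp_def nt_hcomp_def)

lemma nat_trans_id:
  assumes "cat_functor A B F"
  shows "nat_trans A B F F (nt_id A B F)"
proof -
  interpret cat_functor A B F by fact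
  show ?thesis
    unfolding nt_id_def
    by (rule nat_trans_restrictI)
      (auto simp: assms OMap_obj B.Ident_in_hom dest!: AMap_in_hom intro!: B.Comp_Ident_left[THEN trans] B.Comp_Ident_right[symmetric])
qed

lemma nat_trans_vcomp:
  assumes "nat_trans A B F G \<alpha>" "nat_trans A B G H \<beta>"
  shows "nat_trans A B F H (nt_vcomp A B \<beta> \<alpha>)"
proof -
  interpret a: nat_trans A B F G \<alpha> by fact
  interpret b: nat_trans A B G H \<beta> by fact
  show ?thesis
    unfolding nt_vcomp_def
  proof (rule nat_trans_restrictI)
    show "in_hom B (Comp B (\<beta> a) (\<alpha> a)) (OMap F a) (OMap H a)" if "a \<in> Obj A" for a
      using that by (blast intro: a.F.B.Comp_in_hom a.component_in_hom b.component_in_hom)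
    fix f x y
    assume f: "in_hom A f x y"
    note xy = a.F.A.in_hom_obj[OF f]
    note ax = a.component_in_hom[OF xy(1)] and ay = a.component_in_hom[OF xy(2)]
    note bx = b.component_in_hom[OF xy(1)] and by' = b.component_in_hom[OF xy(2)]
    show "Comp B (Comp B (\<beta> y) (\<alpha> y)) (AMap F f) = Comp B (AMap H f) (Comp B (\<beta> x) (\<alpha> x))"
      using a.F.B.Comp_assoc[OF a.F.AMap_in_hom[OF f] ay by']
        a.F.B.Comp_assoc[OF ax a.G.AMap_in_hom[OF f] by'] a.F.B.Comp_assoc[OF ax bx b.G.AMap_in_hom[OF f]]
        a.naturality[OF f] b.naturality[OF f] by simp
  qed (rule a.F.cat_functor_axioms b.G.cat_functor_axioms)+
qed

text \<open>The naturality square of the composite is pasted from the image under \<open>G\<close>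
  of that of \<alpha> at \<open>f\<close> and that of \<beta> at \<open>F' f\<close>.\<close>

lemma nat_trans_hcomp:
  assumes "nat_trans A B F F' \<alpha>" "nat_trans B C G G' \<beta>"
  shows "nat_trans A C (fcomp A G F) (fcomp A G' F') (nt_hcomp A C G F' \<beta> \<alpha>)"
proof -
  interpret a: nat_trans A B F F' \<alpha> by fact
  interpret b: nat_trans B C G G' \<beta> by fact
  note FG = a.F.cat_functor_axioms a.G.cat_functor_axioms b.F.cat_functor_axioms b.G.cat_functor_axioms
  have comps: "in_hom C (AMap G (\<alpha> x)) (OMap G (OMap F x)) (OMap G (OMap F' x))"
    "in_hom C (\<beta> (OMap F' x)) (OMap G (OMap F' x)) (OMap G' (OMap F' x))" if "x \<in> Obj A" for x
    using that b.F.AMap_in_hom[OF a.component_in_hom] b.component_in_hom[OF a.G.OMap_obj] by auto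
  show ?thesis
    unfolding nt_hcomp_def
  proof (rule nat_trans_restrictI)
    show "cat_functor A C (fcomp A G F)" "cat_functor A C (fcomp A G' F')"
      using FG by (blast intro: cat_functor_fcomp)+
    show "in_hom C (Comp C (\<beta> (OMap F' a)) (AMap G (\<alpha> a))) (OMap (fcomp A G F) a) (OMap (fcomp A G' F') a)"
      if "a \<in> Obj A" for a
      using that comps by (auto intro: b.F.B.Comp_in_hom)
    fix f x y
    assume f: "in_hom A f x y"
    note xy = a.F.A.in_hom_obj[OF f]
    note cx = comps[OF xy(1)] and cy = comps[OF xy(2)]
    note Ff = a.F.AMap_in_hom[OF f] and F'f = a.G.AMap_in_hom[OF f]
    note GFf = b.F.AMap_in_hom[OF Ff] and GF'f = b.F.AMap_in_hom[OF F'f]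
      and G'F'f = b.G.AMap_in_hom[OF F'f]
    have "Comp C (Comp C (\<beta> (OMap F' y)) (AMap G (\<alpha> y))) (AMap G (AMap F f)) =
        Comp C (\<beta> (OMap F' y)) (AMap G (Comp B (\<alpha> y) (AMap F f)))"
      using b.F.B.Comp_assoc[OF GFf cy] b.F.AMap_Comp[OF Ff a.component_in_hom[OF xy(2)]] by simp
    also have "\<dots> = Comp C (Comp C (\<beta> (OMap F' y)) (AMap G (AMap F' f))) (AMap G (\<alpha> x))"
      using b.F.B.Comp_assoc[OF cx(1) GF'f cy(2)] a.naturality[OF f]
        b.F.AMap_Comp[OF a.component_in_hom[OF xy(1)] F'f] by simp
    also have "\<dots> = Comp C (AMap G' (AMap F' f)) (Comp C (\<beta> (OMap F' x)) (AMap G (\<alpha> x)))"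
      using b.F.B.Comp_assoc[OF cx G'F'f] b.naturality[OF F'f] by simp
    finally show "Comp C (Comp C (\<beta> (OMap F' y)) (AMap G (\<alpha> y))) (AMap (fcomp A G F) f) =
        Comp C (AMap (fcomp A G' F') f) (Comp C (\<beta> (OMap F' x)) (AMap G (\<alpha> x)))"
      using in_homD(1)[OF f] by simp
  qed
qed

lemma nt_extensional [simp]:
  "nt_id A B F \<in> extensional (Obj A)" "nt_vcomp A B \<beta> \<alpha> \<in> extensional (Obj A)"
  "nt_hcomp A C G F' \<gamma> \<alpha>' \<in> extensional (Obj A)"
  by (simp_all add: nt_id_def nt_vcomp_def nt_hcomp_def)

lemma nt_vcomp_id_right:
  assumes "nat_trans A B F G \<alpha>"
  shows "nt_vcomp A B \<alpha> (nt_id A B F) = \<alpha>"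
proof -
  interpret nat_trans A B F G \<alpha> by fact
  show ?thesis
    by (rule extensionalityI[where A = "Obj A"]) (use component_ext in \<open>auto intro: F.B.Comp_Ident_right[OF component_in_hom]\<close>)
qed

lemma nt_vcomp_id_left:
  assumes "nat_trans A B F G \<alpha>"
  shows "nt_vcomp A B (nt_id A B G) \<alpha> = \<alpha>"
proof -
  interpret nat_trans A B F G \<alpha> by fact
  show ?thesis
    by (rule extensionalityI[where A = "Obj A"]) (use component_ext in \<open>auto intro: F.B.Comp_Ident_left[OF component_in_hom]\<close>)
qed

lemma nt_vcomp_assoc:
  assumes "nat_trans A B F G \<alpha>" "nat_trans A B G H \<beta>" "nat_trans A B H I \<gamma>"
  shows "nt_vcomp A B \<gamma> (nt_vcomp A B \<beta> \<alpha>) = nt_vcomp A B (nt_vcomp A B \<gamma> \<beta>) \<alpha>"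
proof -
  interpret a: nat_trans A B F G \<alpha> by fact
  interpret b: nat_trans A B G H \<beta> by fact
  interpret c: nat_trans A B H I \<gamma> by fact
  show ?thesis
    by (rule extensionalityI[where A = "Obj A"])
      (auto intro: a.F.B.Comp_assoc[OF a.component_in_hom b.component_in_hom c.component_in_hom])
qed

lemma nt_hcomp_id_right:
  assumes "nat_trans A B F G \<alpha>"
  shows "nt_hcomp A B F (fid A) \<alpha> (nt_id A A (fid A)) = \<alpha>"
proof -
  interpret nat_trans A B F G \<alpha> by fact
  show ?thesis
    by (rule extensionalityI[where A = "Obj A"])
      (use component_ext in \<open>auto simp: F.AMap_Ident intro: F.B.Comp_Ident_right[OF component_in_hom]\<close>)
qed

lemma nt_hcomp_id_left:
  assumes "nat_trans A B F G \<alpha>"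
  shows "nt_hcomp A B (fid B) G (nt_id B B (fid B)) \<alpha> = \<alpha>"
proof -
  interpret nat_trans A B F G \<alpha> by fact
  show ?thesis
    by (rule extensionalityI[where A = "Obj A"])
      (use component_ext in \<open>auto simp: G.OMap_obj component_arr intro: F.B.Comp_Ident_left[OF component_in_hom]\<close>)
qed

lemma nt_hcomp_assoc:
  assumes "nat_trans A B F F' \<alpha>" "nat_trans B C G G' \<beta>" "nat_trans C D H H' \<gamma>"
  shows "nt_hcomp A D H (fcomp A G' F') \<gamma> (nt_hcomp A C G F' \<beta> \<alpha>) =
    nt_hcomp A D (fcomp B H G) F' (nt_hcomp B D H G' \<gamma> \<beta>) \<alpha>"
proof -
  interpret a: nat_trans A B F F' \<alpha> by fact
  interpret b: nat_trans B C G G' \<beta> by fact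
  interpret c: nat_trans C D H H' \<gamma> by fact
  show ?thesis
  proof (rule extensionalityI[where A = "Obj A"])
    fix x
    assume x: "x \<in> Obj A"
    note Gax = b.F.AMap_in_hom[OF a.component_in_hom[OF x]]
    note bx = b.component_in_hom[OF a.G.OMap_obj[OF x]]
    note cx = c.component_in_hom[OF b.G.OMap_obj[OF a.G.OMap_obj[OF x]]]
    show "nt_hcomp A D H (fcomp A G' F') \<gamma> (nt_hcomp A C G F' \<beta> \<alpha>) x =
        nt_hcomp A D (fcomp B H G) F' (nt_hcomp B D H G' \<gamma> \<beta>) \<alpha> x"
      using x c.F.AMap_Comp[OF Gax bx] c.F.B.Comp_assoc[OF c.F.AMap_in_hom[OF Gax] c.F.AMap_in_hom[OF bx] cx]
      by (simp add: a.G.OMap_obj a.component_arr)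
  qed auto
qed

lemma nt_hcomp_id:
  assumes "cat_functor A B F" "cat_functor B C G"
  shows "nt_hcomp A C G F (nt_id B C G) (nt_id A B F) = nt_id A C (fcomp A G F)"
proof -
  interpret F: cat_functor A B F by fact
  interpret G: cat_functor B C G by fact
  show ?thesis
    by (rule extensionalityI[where A = "Obj A"])
      (auto simp: F.OMap_obj G.OMap_obj G.AMap_Ident intro!: G.B.Comp_Ident_left G.B.Ident_in_hom)
qed

lemma nt_interchange:
  assumes "nat_trans A B F F' \<alpha>" "nat_trans A B F' F'' \<alpha>'"
    and "nat_trans B C G G' \<beta>" "nat_trans B C G' G'' \<beta>'"
  shows "nt_hcomp A C G F'' (nt_vcomp B C \<beta>' \<beta>) (nt_vcomp A B \<alpha>' \<alpha>) =
    nt_vcomp A C (nt_hcomp A C G' F'' \<beta>' \<alpha>') (nt_hcomp A C G F' \<beta> \<alpha>)"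
proof -
  interpret a: nat_trans A B F F' \<alpha> by fact
  interpret a': nat_trans A B F' F'' \<alpha>' by fact
  interpret b: nat_trans B C G G' \<beta> by fact
  interpret b': nat_trans B C G' G'' \<beta>' by fact
  show ?thesis
  proof (rule extensionalityI[where A = "Obj A"])
    fix x
    assume x: "x \<in> Obj A"
    note ax = a.component_in_hom[OF x] and a'x = a'.component_in_hom[OF x]
    note bx = b.component_in_hom[OF a.G.OMap_obj[OF x]]
    note bx' = b.component_in_hom[OF a'.G.OMap_obj[OF x]]
    note b'x = b'.component_in_hom[OF a'.G.OMap_obj[OF x]]
    note Ga = b.F.AMap_in_hom[OF ax] and Ga' = b.F.AMap_in_hom[OF a'x] and G'a' = b.G.AMap_in_hom[OF a'x]
    note assoc = b.F.B.Comp_assoc and comp = b.F.B.Comp_in_hom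
    have "Comp C (Comp C (\<beta>' (OMap F'' x)) (\<beta> (OMap F'' x))) (AMap G (Comp B (\<alpha>' x) (\<alpha> x)))
        = Comp C (\<beta>' (OMap F'' x)) (Comp C (Comp C (\<beta> (OMap F'' x)) (AMap G (\<alpha>' x))) (AMap G (\<alpha> x)))"
      using b.F.AMap_Comp[OF ax a'x] assoc[OF comp[OF Ga Ga'] bx' b'x] assoc[OF Ga Ga' bx'] by simp
    \<comment> \<open>The only exchange of factors: naturality of \<beta> at the arrow
      \<open>\<alpha>' x\<close>. The neighbouring steps use associativity and functoriality of
      \<open>G\<close>.\<close>
    also have "\<dots> = Comp C (\<beta>' (OMap F'' x)) (Comp C (Comp C (AMap G' (\<alpha>' x)) (\<beta> (OMap F' x))) (AMap G (\<alpha> x)))"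
      using b.naturality[OF a'x] by simp
    also have "\<dots> = Comp C (Comp C (\<beta>' (OMap F'' x)) (AMap G' (\<alpha>' x))) (Comp C (\<beta> (OMap F' x)) (AMap G (\<alpha> x)))"
      using assoc[OF Ga bx G'a'] assoc[OF comp[OF Ga bx] G'a' b'x] by simp
    finally show "nt_hcomp A C G F'' (nt_vcomp B C \<beta>' \<beta>) (nt_vcomp A B \<alpha>' \<alpha>) x =
        nt_vcomp A C (nt_hcomp A C G' F'' \<beta>' \<alpha>') (nt_hcomp A C G F' \<beta> \<alpha>) x"
      using x by (simp add: a'.G.OMap_obj)
  qed auto
qed


section \<open>The arrow category and pullbacks\<close>

lemma squaresD:
  assumes "s \<in> squares C"
  shows "sq_left s \<in> Arr C" "sq_right s \<in> Arr C"
    "in_hom C (sq_left s) (Dom C (sq_left s)) (Cod C (sq_left s))"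
    "in_hom C (sq_right s) (Dom C (sq_right s)) (Cod C (sq_right s))"
    "in_hom C (sq_top s) (Dom C (sq_left s)) (Dom C (sq_right s))"
    "in_hom C (sq_bot s) (Cod C (sq_left s)) (Cod C (sq_right s))"
    "Comp C (sq_right s) (sq_top s) = Comp C (sq_bot s) (sq_left s)"
  using assms by (auto simp: squares_def in_hom_def)

lemma arrow_cat_simps [simp]:
  "Obj (arrow_cat C) = Arr C"
  "Arr (arrow_cat C) = squares C"
  "s \<in> squares C \<Longrightarrow> Dom (arrow_cat C) s = sq_left s"
  "s \<in> squares C \<Longrightarrow> Cod (arrow_cat C) s = sq_right s"
  "f \<in> Arr C \<Longrightarrow> Ident (arrow_cat C) f = Square f (Ident C (Dom C f)) (Ident C (Cod C f)) f"
  "s \<in> squares C \<Longrightarrow> t \<in> squares C \<Longrightarrow> sq_left t = sq_right s \<Longrightarrow> Comp (arrow_cat C) t s =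
    Square (sq_left s) (Comp C (sq_top t) (sq_top s)) (Comp C (sq_bot t) (sq_bot s)) (sq_right t)"
  "in_hom (arrow_cat C) s f g \<longleftrightarrow> s \<in> squares C \<and> sq_left s = f \<and> sq_right s = g"
  by (auto simp: arrow_cat_def)

context category
begin

lemma Ident_square: "f \<in> Arr C \<Longrightarrow> Square f (Ident C (Dom C f)) (Ident C (Cod C f)) f \<in> squares C"
  using Ident_in_hom[OF Dom_obj] Ident_in_hom[OF Cod_obj]
    Comp_Ident_left[of f "Dom C f" "Cod C f"] Comp_Ident_right[of f "Dom C f" "Cod C f"]
  by (simp add: squares_def in_hom_def)

text \<open>Pasting of two commuting squares along the common edge \<open>sq_right s\<close>, which
  is \<open>sq_left t\<close>.\<close>

lemma Comp_square:
  assumes s: "s \<in> squares C" and t: "t \<in> squares C" and st: "sq_left t = sq_right s"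
  shows "Square (sq_left s) (Comp C (sq_top t) (sq_top s)) (Comp C (sq_bot t) (sq_bot s)) (sq_right t)
    \<in> squares C"
proof -
  note s' = squaresD[OF s] and t' = squaresD[OF t, unfolded st]
  have "Comp C (sq_right t) (Comp C (sq_top t) (sq_top s)) =
      Comp C (Comp C (sq_bot t) (sq_right s)) (sq_top s)"
    using Comp_assoc[OF s'(5) t'(5) t'(4)] t'(7) by simp
  also have "\<dots> = Comp C (Comp C (sq_bot t) (sq_bot s)) (sq_left s)"
    using Comp_assoc[OF s'(5) s'(4) t'(6)] Comp_assoc[OF s'(3) s'(6) t'(6)] s'(7) by simp
  finally show ?thesis
    using s' t' Comp_in_hom[OF s'(5) t'(5)] Comp_in_hom[OF s'(6) t'(6)] by (simp add: squares_def)
qed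

lemma category_arrow_cat: "category (arrow_cat C)"
  unfolding arrow_cat_def
\<comment> \<open>Goals 5 to 7 are the two unit laws and associativity; they hold separately for the
  top and the bottom edges.\<close>
proof (rule category_mk_cat, goal_cases)
  case (5 s)
  then show ?case
    using squaresD(5,6)[of s C] by (cases s) (simp add: Comp_Ident_right)
next
  case (6 s)
  then show ?case
    using squaresD(5,6)[of s C] by (cases s) (simp add: Comp_Ident_left)
next
  case (7 s t u)
  note s = squaresD[OF 7(1)] and t = squaresD[OF 7(2)] and u = squaresD[OF 7(3)]
  show ?case
    using Comp_assoc[OF s(5) t(5)[unfolded 7(4)] u(5)[unfolded 7(5)]]
      Comp_assoc[OF s(6) t(6)[unfolded 7(4)] u(6)[unfolded 7(5)]] by simp
qed (auto dest: squaresD(1,2) intro: Ident_square Comp_square)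

end

lemma cod_functor_simps [simp]:
  "f \<in> Arr C \<Longrightarrow> OMap (cod_functor C) f = Cod C f"
  "s \<in> squares C \<Longrightarrow> AMap (cod_functor C) s = sq_bot s"
  by (simp_all add: cod_functor_def)

lemma arrow_functor_simps [simp]:
  "f \<in> Arr C \<Longrightarrow> OMap (arrow_functor C F) f = AMap F f"
  "s \<in> squares C \<Longrightarrow> AMap (arrow_functor C F) s = map_square (AMap F) s"
  by (simp_all add: arrow_functor_def)

context cat_functor
begin

lemma map_square_squares:
  assumes "s \<in> squares A"
  shows "map_square (AMap F) s \<in> squares B"
  using squaresD[OF assms] AMap_in_hom[OF squaresD(5)[OF assms]] AMap_in_hom[OF squaresD(6)[OF assms]]
    AMap_Comp[OF squaresD(5,4)[OF assms]] AMap_Comp[OF squaresD(3,6)[OF assms]]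
  by (simp add: squares_def square.map_sel AMap_arr)

lemma cat_functor_arrow: "cat_functor (arrow_cat A) (arrow_cat B) (arrow_functor A F)"
  unfolding arrow_functor_def
proof (rule cat_functor_mk_ftor)
  show "map_square (AMap F) (Comp (arrow_cat A) t s) =
      Comp (arrow_cat B) (map_square (AMap F) t) (map_square (AMap F) s)"
    if "in_hom (arrow_cat A) s f g" "in_hom (arrow_cat A) t g h" for s t f g h
  proof -
    have st: "s \<in> squares A" "t \<in> squares A" "sq_left t = sq_right s"
      using that by auto
    note t = squaresD[OF st(2), unfolded st(3)]
    show ?thesis
      using st AMap_Comp[OF squaresD(5)[OF st(1)] t(5)] AMap_Comp[OF squaresD(6)[OF st(1)] t(6)]
      by (simp add: map_square_squares square.map_sel)
  qed
qed (auto simp: A.category_arrow_cat B.category_arrow_cat AMap_arr map_square_squares square.map_sel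
    AMap_Ident A.Dom_obj A.Cod_obj)

end

text \<open>\<open>AMap (fid C)\<close> is the identity only on arrows of \<open>C\<close>; mapping
  it over a square changes nothing because all four edges are arrows of \<open>C\<close>.\<close>

lemma arrow_functor_fid:
  assumes "category C"
  shows "arrow_functor C (fid C) = fid (arrow_cat C)"
proof -
  have "map_square (AMap (fid C)) s = s" if "s \<in> squares C" for s
    using squaresD[OF that] by (cases s) (auto simp: in_hom_def)
  then show ?thesis
    by (simp add: arrow_functor_def fid_def[of "arrow_cat C"] mk_ftor_eq_iff)
qed

lemma arrow_functor_fcomp:
  assumes "cat_functor A B F"
  shows "arrow_functor A (fcomp A G F) = fcomp (arrow_cat A) (arrow_functor B G) (arrow_functor A F)"
proof -
  interpret cat_functor A B F by fact
  have "map_square (AMap (fcomp A G F)) s = map_square (AMap G) (map_square (AMap F) s)"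
    if "s \<in> squares A" for s
    using squaresD[OF that] by (cases s) (auto simp: in_hom_def)
  then show ?thesis
    by (simp add: arrow_functor_def[of A "fcomp A G F"] fcomp_def[of "arrow_cat A"] mk_ftor_eq_iff
        AMap_arr map_square_squares)
qed

section \<open>Pullbacks and isomorphisms of squares over a cospan\<close>

lemma pullbackD:
  assumes "is_pullback C s"
  shows "s \<in> squares C"
    and "in_hom C x w (Dom C (sq_right s)) \<Longrightarrow> in_hom C y w (Cod C (sq_left s)) \<Longrightarrow>
      Comp C (sq_right s) x = Comp C (sq_bot s) y \<Longrightarrow>
      \<exists>!z. in_hom C z w (Dom C (sq_left s)) \<and> Comp C (sq_top s) z = x \<and> Comp C (sq_left s) z = y"
  using assms unfolding is_pullback_def by blast+

text \<open>Isomorphism of cones over a shared cospan: \<open>k\<close> runs from the apex of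
  \<open>t\<close> to the apex of \<open>s\<close>, with inverse \<open>l\<close>, and
  \<open>t\<close> is \<open>s\<close> precomposed with \<open>k\<close>. All clauses are typings
  and equations, without a universal property, so any functor preserves the relation.\<close>

definition square_isomorphism :: "('o, 'a) cat \<Rightarrow> 'a square \<Rightarrow> 'a square \<Rightarrow> 'a \<Rightarrow> 'a \<Rightarrow> bool" where
  "square_isomorphism C s t k l \<longleftrightarrow> s \<in> squares C \<and> t \<in> squares C
     \<and> sq_right s = sq_right t \<and> sq_bot s = sq_bot t
     \<and> in_hom C k (Dom C (sq_left t)) (Dom C (sq_left s))
     \<and> in_hom C l (Dom C (sq_left s)) (Dom C (sq_left t))
     \<and> Comp C k l = Ident C (Dom C (sq_left s)) \<and> Comp C l k = Ident C (Dom C (sq_left t))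
     \<and> Comp C (sq_left s) k = sq_left t \<and> Comp C (sq_top s) k = sq_top t"

context category
begin

text \<open>The uniqueness half of the universal property, for the cone formed by the two composites
  of \<open>z\<close>. That cone is compatible because \<open>s\<close> commutes.\<close>

lemma pullback_hom_eqI:
  assumes s: "is_pullback C s"
    and z: "in_hom C z w (Dom C (sq_left s))" and z': "in_hom C z' w (Dom C (sq_left s))"
    and eq: "Comp C (sq_top s) z = Comp C (sq_top s) z'" "Comp C (sq_left s) z = Comp C (sq_left s) z'"
  shows "z = z'"
proof -
  note s' = squaresD[OF pullbackD(1)[OF s]]
  have "\<exists>!u. in_hom C u w (Dom C (sq_left s)) \<and> Comp C (sq_top s) u = Comp C (sq_top s) z
      \<and> Comp C (sq_left s) u = Comp C (sq_left s) z"
    using Comp_assoc[OF z s'(5,4)] Comp_assoc[OF z s'(3,6)] s'(7)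
    by (intro pullbackD(2)[OF s] Comp_in_hom[OF z] s'(3,5)) simp
  then show ?thesis
    using z z' eq by metis
qed

text \<open>A cone over the cospan has a mediating arrow \<open>z\<close> into the apex of
  \<open>s\<close>; the one for \<open>t\<close> is \<open>l\<close> after \<open>z\<close>. Any
  other mediating arrow \<open>u\<close> for \<open>t\<close> satisfies that \<open>k\<close> after
  \<open>u\<close> equals \<open>z\<close>, and applying \<open>l\<close> recovers
  \<open>u\<close>.\<close>

lemma pullback_square_isomorphism:
  assumes iso: "square_isomorphism C s t k l" and s: "is_pullback C s"
  shows "is_pullback C t"
proof -
  have eq: "sq_right t = sq_right s" "sq_bot t = sq_bot s"
    and k: "in_hom C k (Dom C (sq_left t)) (Dom C (sq_left s))"
    and l: "in_hom C l (Dom C (sq_left s)) (Dom C (sq_left t))"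
    and kl: "Comp C k l = Ident C (Dom C (sq_left s))" "Comp C l k = Ident C (Dom C (sq_left t))"
    and left: "sq_left t = Comp C (sq_left s) k" and top: "sq_top t = Comp C (sq_top s) k"
    and t: "t \<in> squares C"
    using iso unfolding square_isomorphism_def by simp_all
  note s' = squaresD[OF pullbackD(1)[OF s]]
  have Cod_eq: "Cod C (sq_left t) = Cod C (sq_left s)"
    using in_homD(3)[OF Comp_in_hom[OF k s'(3)]] by (simp add: left)
  show ?thesis
    unfolding is_pullback_def
  proof (intro conjI allI impI; (elim conjE)?)
    fix w x y
    assume x: "in_hom C x w (Dom C (sq_right t))" and y: "in_hom C y w (Cod C (sq_left t))"
      and xy: "Comp C (sq_right t) x = Comp C (sq_bot t) y"
    obtain z where z: "in_hom C z w (Dom C (sq_left s))" "Comp C (sq_top s) z = x" "Comp C (sq_left s) z = y"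
      using pullbackD(2)[OF s] x y xy unfolding eq Cod_eq by blast
    show "\<exists>!z. in_hom C z w (Dom C (sq_left t)) \<and> Comp C (sq_top t) z = x \<and> Comp C (sq_left t) z = y"
    proof (rule ex1I[where a = "Comp C l z"], intro conjI)
      have klz: "Comp C k (Comp C l z) = z"
        using Comp_cancel_inverse[OF k l kl(1) z(1)] .
      note lz = Comp_in_hom[OF z(1) l]
      show "in_hom C (Comp C l z) w (Dom C (sq_left t))"
        by (rule lz)
      show "Comp C (sq_top t) (Comp C l z) = x" "Comp C (sq_left t) (Comp C l z) = y"
        using Comp_assoc[OF lz k s'(5)] Comp_assoc[OF lz k s'(3)] klz z(2,3) by (simp_all add: left top)
    next
      fix u
      assume u: "in_hom C u w (Dom C (sq_left t)) \<and> Comp C (sq_top t) u = x \<and> Comp C (sq_left t) u = y"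
      then have u': "in_hom C u w (Dom C (sq_left t))"
        by blast
      have "Comp C k u = z"
        using u Comp_assoc[OF u' k s'(5)] Comp_assoc[OF u' k s'(3)] z
        by (intro pullback_hom_eqI[OF s Comp_in_hom[OF u' k] z(1)]) (simp_all add: left top)
      then show "u = Comp C l z"
        using Comp_cancel_inverse[OF l k kl(2) u'] by simp
    qed
  qed (rule t)
qed

text \<open>Each square is a cone for the other, which gives \<open>k\<close> and \<open>l\<close>.
  The round trips agree with the identities after composition with both legs, so
  \<open>pullback_hom_eqI\<close> identifies them.\<close>

lemma pullback_unique:
  assumes s: "is_pullback C s" and t: "is_pullback C t"
    and eq: "sq_right s = sq_right t" "sq_bot s = sq_bot t"
  shows "\<exists>k l. square_isomorphism C s t k l"
proof -
  note s' = squaresD[OF pullbackD(1)[OF s]] and t' = squaresD[OF pullbackD(1)[OF t]]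
  have Cod_eq: "Cod C (sq_left s) = Cod C (sq_left t)"
    using s'(6) t'(6) eq by (simp add: in_hom_def)
  obtain k where k: "in_hom C k (Dom C (sq_left t)) (Dom C (sq_left s))"
      "Comp C (sq_top s) k = sq_top t" "Comp C (sq_left s) k = sq_left t"
    using pullbackD(2)[OF s, unfolded eq Cod_eq, OF t'(5,3,7)] by blast
  obtain l where l: "in_hom C l (Dom C (sq_left s)) (Dom C (sq_left t))"
      "Comp C (sq_top t) l = sq_top s" "Comp C (sq_left t) l = sq_left s"
    using pullbackD(2)[OF t, folded eq Cod_eq, OF s'(5,3,7)] by blast
  note ids = Ident_in_hom[OF Dom_obj[OF s'(1)]] Ident_in_hom[OF Dom_obj[OF t'(1)]]
  have "Comp C k l = Ident C (Dom C (sq_left s))"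
    using Comp_assoc[OF l(1) k(1) s'(5)] Comp_assoc[OF l(1) k(1) s'(3)] k l
      Comp_Ident_right[OF s'(5)] Comp_Ident_right[OF s'(3)]
    by (intro pullback_hom_eqI[OF s Comp_in_hom[OF l(1) k(1)] ids(1)]) simp_all
  moreover have "Comp C l k = Ident C (Dom C (sq_left t))"
    using Comp_assoc[OF k(1) l(1) t'(5)] Comp_assoc[OF k(1) l(1) t'(3)] k l
      Comp_Ident_right[OF t'(5)] Comp_Ident_right[OF t'(3)]
    by (intro pullback_hom_eqI[OF t Comp_in_hom[OF k(1) l(1)] ids(2)]) simp_all
  ultimately show ?thesis
    unfolding square_isomorphism_def
    using k l eq pullbackD(1)[OF s] pullbackD(1)[OF t] by blast
qed

end

text \<open>Together with \<open>pullback_unique\<close> and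
  \<open>pullback_square_isomorphism\<close>, this lets preservation of one pullback of a cospan
  imply preservation of all of them.\<close>

lemma square_isomorphism_map:
  assumes "cat_functor A B F" and iso: "square_isomorphism A s t k l"
  shows "square_isomorphism B (map_square (AMap F) s) (map_square (AMap F) t) (AMap F k) (AMap F l)"
proof -
  interpret cat_functor A B F by fact
  have s: "s \<in> squares A" and t: "t \<in> squares A"
    and k: "in_hom A k (Dom A (sq_left t)) (Dom A (sq_left s))"
    and l: "in_hom A l (Dom A (sq_left s)) (Dom A (sq_left t))"
    and eqs: "Comp A k l = Ident A (Dom A (sq_left s))" "Comp A l k = Ident A (Dom A (sq_left t))"
      "Comp A (sq_left s) k = sq_left t" "Comp A (sq_top s) k = sq_top t"
      "sq_right s = sq_right t" "sq_bot s = sq_bot t"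
    using iso unfolding square_isomorphism_def by simp_all
  note objs = A.Dom_obj[OF squaresD(1)[OF s]] A.Dom_obj[OF squaresD(1)[OF t]]
  have "Comp B (AMap F k) (AMap F l) = Ident B (OMap F (Dom A (sq_left s)))"
    "Comp B (AMap F l) (AMap F k) = Ident B (OMap F (Dom A (sq_left t)))"
    "Comp B (AMap F (sq_left s)) (AMap F k) = AMap F (sq_left t)"
    "Comp B (AMap F (sq_top s)) (AMap F k) = AMap F (sq_top t)"
    using AMap_Comp[OF l k] AMap_Comp[OF k l] AMap_Comp[OF k squaresD(3)[OF s]]
      AMap_Comp[OF k squaresD(5)[OF s]] objs by (simp_all add: eqs AMap_Ident)
  then show ?thesis
    using s t AMap_in_hom[OF k] AMap_in_hom[OF l] squaresD(1)[OF s] squaresD(1)[OF t]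
    by (simp add: square_isomorphism_def square.map_sel map_square_squares AMap_arr eqs)
qed


section \<open>Full subcategories of the arrow category\<close>

definition full_arrow_subcat :: "('o, 'a) cat \<Rightarrow> 'a set \<Rightarrow> ('a, 'a square) cat" where
  "full_arrow_subcat C S = mk_cat S {s \<in> squares C. sq_left s \<in> S \<and> sq_right s \<in> S} sq_left sq_right
     (Ident (arrow_cat C)) (Comp (arrow_cat C))"

lemma full_arrow_subcat_simps [simp]:
  "Obj (full_arrow_subcat C S) = S"
  "s \<in> Arr (full_arrow_subcat C S) \<longleftrightarrow> s \<in> squares C \<and> sq_left s \<in> S \<and> sq_right s \<in> S"
  "s \<in> squares C \<Longrightarrow> sq_left s \<in> S \<Longrightarrow> sq_right s \<in> S \<Longrightarrow> Dom (full_arrow_subcat C S) s = sq_left s"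
  "s \<in> squares C \<Longrightarrow> sq_left s \<in> S \<Longrightarrow> sq_right s \<in> S \<Longrightarrow> Cod (full_arrow_subcat C S) s = sq_right s"
  "f \<in> S \<Longrightarrow> Ident (full_arrow_subcat C S) f = Ident (arrow_cat C) f"
  "s \<in> squares C \<Longrightarrow> t \<in> squares C \<Longrightarrow> sq_left t = sq_right s \<Longrightarrow> sq_left s \<in> S \<Longrightarrow>
    sq_right s \<in> S \<Longrightarrow> sq_right t \<in> S \<Longrightarrow>
    Comp (full_arrow_subcat C S) t s = Comp (arrow_cat C) t s"
  "in_hom (full_arrow_subcat C S) s f g \<longleftrightarrow> s \<in> squares C \<and> sq_left s = f \<and> sq_right s = g \<and> f \<in> S \<and> g \<in> S"
  by (auto simp: full_arrow_subcat_def)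

context category
begin

lemma category_full_arrow_subcat:
  assumes "S \<subseteq> Arr C"
  shows "category (full_arrow_subcat C S)"
proof -
  interpret arr: category "arrow_cat C" by (rule category_arrow_cat)
  show ?thesis
    unfolding full_arrow_subcat_def
  proof (rule category_mk_cat, goal_cases)
    case (5 s)
    then show ?case using arr.Comp_Ident_right[of s "sq_left s" "sq_right s"] by simp
  next
    case (6 s)
    then show ?case using arr.Comp_Ident_left[of s "sq_left s" "sq_right s"] by simp
  next
    case (7 s t u)
    then show ?case
      using arr.Comp_assoc[of s "sq_left s" "sq_right s" t "sq_right t" u "sq_right u"] by simp
  qed (use assms in \<open>auto simp: subset_iff intro: Ident_square Comp_square\<close>)
qed

end

text \<open>Equality of records, field by field. Each operation is extensional on both sides, so
  agreement where it is defined suffices; on pairs that do not compose, \<open>Comp\<close> is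
  \<open>undefined\<close> on both sides.\<close>

lemma full_arrow_subcat_eqI:
  assumes T: "category T" and C: "category C" and S: "Obj T \<subseteq> Arr C"
    and arr: "\<And>s. s \<in> Arr T \<longleftrightarrow> s \<in> squares C \<and> sq_left s \<in> Obj T \<and> sq_right s \<in> Obj T"
    and dom: "\<And>s. s \<in> Arr T \<Longrightarrow> Dom T s = sq_left s" and cod: "\<And>s. s \<in> Arr T \<Longrightarrow> Cod T s = sq_right s"
    and id: "\<And>f. f \<in> Obj T \<Longrightarrow> Ident T f = Ident (arrow_cat C) f"
    and comp: "\<And>s t. s \<in> Arr T \<Longrightarrow> t \<in> Arr T \<Longrightarrow> Dom T t = Cod T s \<Longrightarrow> Comp T t s = Comp (arrow_cat C) t s"
  shows "T = full_arrow_subcat C (Obj T)"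
proof -
  interpret T: category T by fact
  interpret C: category C by fact
  interpret F: category "full_arrow_subcat C (Obj T)" by (rule C.category_full_arrow_subcat[OF S])
  let ?F = "full_arrow_subcat C (Obj T)"
  have Arr_eq: "Arr T = Arr ?F"
    by (simp add: set_eq_iff arr)
  have Dom_eq: "Dom T = Dom ?F"
  proof (rule extensionalityI[of _ "Arr T"])
    show "Dom T \<in> extensional (Arr T)" "Dom ?F \<in> extensional (Arr T)"
      using T.Dom_ext F.Dom_ext unfolding Arr_eq PiE_def by blast+
    show "Dom T s = Dom ?F s" if "s \<in> Arr T" for s
      using that arr[of s] dom[of s] by simp
  qed
  have Cod_eq: "Cod T = Cod ?F"
  proof (rule extensionalityI[of _ "Arr T"])
    show "Cod T \<in> extensional (Arr T)" "Cod ?F \<in> extensional (Arr T)"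
      using T.Cod_ext F.Cod_ext unfolding Arr_eq PiE_def by blast+
    show "Cod T s = Cod ?F s" if "s \<in> Arr T" for s
      using that arr[of s] cod[of s] by simp
  qed
  have Ident_eq: "Ident T = Ident ?F"
    using T.Ident_ext F.Ident_ext by (intro extensionalityI[of _ "Obj T"]) (simp_all add: id)
  have "Comp T t s = Comp ?F t s" for s t
  proof (cases "s \<in> Arr T \<and> t \<in> Arr T \<and> Dom T t = Cod T s")
    case True
    then show ?thesis
      using comp[of s t] arr[of s] arr[of t] dom[of t] cod[of s] by simp
  next
    case False
    then show ?thesis
      using T.Comp_ext[OF False] F.Comp_ext[OF False[unfolded Arr_eq Dom_eq Cod_eq]] by simp
  qed
  then have "Comp T = Comp ?F"
    by blast
  with Arr_eq Dom_eq Cod_eq Ident_eq show ?thesis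
    by (intro cat.equality) simp_all
qed


section \<open>Assembling a 2-category from 1-cells and tagged 2-cells\<close>

text \<open>In \<open>hc A C G F' \<beta> \<alpha>\<close> the 1-cells \<open>G\<close> and \<open>F'\<close> are the source of \<open>\<beta>\<close> and the target of \<open>\<alpha>\<close>,
  the two which occur in the formula for the components of a horizontal composite.\<close>

locale tagged_two_cells =
  fixes Ob :: "'x set"
    and P :: "'x \<Rightarrow> 'x \<Rightarrow> 'f \<Rightarrow> bool"
    and Q :: "'x \<Rightarrow> 'x \<Rightarrow> 'f \<Rightarrow> 'f \<Rightarrow> 'n \<Rightarrow> bool"
    and u1 :: "'x \<Rightarrow> 'f"
    and u2 :: "'x \<Rightarrow> 'x \<Rightarrow> 'f \<Rightarrow> 'n"
    and vc :: "'x \<Rightarrow> 'x \<Rightarrow> 'n \<Rightarrow> 'n \<Rightarrow> 'n"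
    and c1 :: "'x \<Rightarrow> 'f \<Rightarrow> 'f \<Rightarrow> 'f"
    and hc :: "'x \<Rightarrow> 'x \<Rightarrow> 'f \<Rightarrow> 'f \<Rightarrow> 'n \<Rightarrow> 'n \<Rightarrow> 'n"
  assumes Q_P: "Q A B F G \<alpha> \<Longrightarrow> P A B F \<and> P A B G"
    and u1_cell: "A \<in> Ob \<Longrightarrow> P A A (u1 A)"
    and u2_cell: "P A B F \<Longrightarrow> Q A B F F (u2 A B F)"
    and vc_cell: "Q A B F G \<alpha> \<Longrightarrow> Q A B G H \<beta> \<Longrightarrow> Q A B F H (vc A B \<beta> \<alpha>)"
    and c1_cell: "P A B F \<Longrightarrow> P B C G \<Longrightarrow> P A C (c1 A G F)"
    and hc_cell: "Q A B F F' \<alpha> \<Longrightarrow> Q B C G G' \<beta> \<Longrightarrow> Q A C (c1 A G F) (c1 A G' F') (hc A C G F' \<beta> \<alpha>)"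
    and vc_u2_right: "Q A B F G \<alpha> \<Longrightarrow> vc A B \<alpha> (u2 A B F) = \<alpha>"
    and vc_u2_left: "Q A B F G \<alpha> \<Longrightarrow> vc A B (u2 A B G) \<alpha> = \<alpha>"
    and vc_assoc: "Q A B F G \<alpha> \<Longrightarrow> Q A B G H \<beta> \<Longrightarrow> Q A B H I \<gamma> \<Longrightarrow>
      vc A B \<gamma> (vc A B \<beta> \<alpha>) = vc A B (vc A B \<gamma> \<beta>) \<alpha>"
    and c1_u1_right: "P A B F \<Longrightarrow> c1 A F (u1 A) = F"
    and c1_u1_left: "P A B F \<Longrightarrow> c1 A (u1 B) F = F"
    and c1_assoc: "P A B F \<Longrightarrow> P B C G \<Longrightarrow> P C D H \<Longrightarrow> c1 A H (c1 A G F) = c1 A (c1 B H G) F"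
    and hc_u2: "P A B F \<Longrightarrow> P B C G \<Longrightarrow> hc A C G F (u2 B C G) (u2 A B F) = u2 A C (c1 A G F)"
    and hc_vc: "Q A B F F' \<alpha> \<Longrightarrow> Q A B F' F'' \<alpha>' \<Longrightarrow> Q B C G G' \<beta> \<Longrightarrow> Q B C G' G'' \<beta>' \<Longrightarrow>
      hc A C G F'' (vc B C \<beta>' \<beta>) (vc A B \<alpha>' \<alpha>) = vc A C (hc A C G' F'' \<beta>' \<alpha>') (hc A C G F' \<beta> \<alpha>)"
    and hc_u2_right: "Q A B F G \<alpha> \<Longrightarrow> hc A B F (u1 A) \<alpha> (u2 A A (u1 A)) = \<alpha>"
    and hc_u2_left: "Q A B F G \<alpha> \<Longrightarrow> hc A B (u1 B) G (u2 B B (u1 B)) \<alpha> = \<alpha>"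
    and hc_assoc: "Q A B F F' \<alpha> \<Longrightarrow> Q B C G G' \<beta> \<Longrightarrow> Q C D H H' \<gamma> \<Longrightarrow>
      hc A D H (c1 A G' F') \<gamma> (hc A C G F' \<beta> \<alpha>) = hc A D (c1 B H G) F' (hc B D H G' \<gamma> \<beta>) \<alpha>"
begin

text \<open>The shape is that of \<open>dmc_hom\<close> and \<open>compcat_hom\<close>, so that both
  become instances by unfolding.\<close>

definition hom :: "'x \<Rightarrow> 'x \<Rightarrow> ('f, ('f, 'n) cell2) cat" where
  "hom A B = mk_cat {F. P A B F} {\<sigma>. Q A B (src2 \<sigma>) (trg2 \<sigma>) (body2 \<sigma>)} src2 trg2
     (\<lambda>F. Cell2 F (u2 A B F) F)
     (\<lambda>\<tau> \<sigma>. Cell2 (src2 \<sigma>) (vc A B (body2 \<tau>) (body2 \<sigma>)) (trg2 \<tau>))"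

definition hcomp :: "'x \<Rightarrow> 'x \<Rightarrow> 'x \<Rightarrow>
    ('f \<times> 'f, ('f, 'n) cell2 \<times> ('f, 'n) cell2, 'f, ('f, 'n) cell2) ftor" where
  "hcomp A B C = mk_ftor (prod_cat (hom B C) (hom A B))
     (\<lambda>(G, F). c1 A G F)
     (\<lambda>(\<tau>, \<sigma>). Cell2 (c1 A (src2 \<tau>) (src2 \<sigma>)) (hc A C (src2 \<tau>) (trg2 \<sigma>) (body2 \<tau>) (body2 \<sigma>))
        (c1 A (trg2 \<tau>) (trg2 \<sigma>)))"

lemma hom_simps [simp]:
  "F \<in> Obj (hom A B) \<longleftrightarrow> P A B F"
  "\<sigma> \<in> Arr (hom A B) \<longleftrightarrow> Q A B (src2 \<sigma>) (trg2 \<sigma>) (body2 \<sigma>)"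
  "P A B F \<Longrightarrow> Ident (hom A B) F = Cell2 F (u2 A B F) F"
  "in_hom (hom A B) \<sigma> F G \<longleftrightarrow> Q A B F G (body2 \<sigma>) \<and> src2 \<sigma> = F \<and> trg2 \<sigma> = G"
  "Q A B (src2 \<sigma>) (trg2 \<sigma>) (body2 \<sigma>) \<Longrightarrow> Q A B (src2 \<tau>) (trg2 \<tau>) (body2 \<tau>) \<Longrightarrow> src2 \<tau> = trg2 \<sigma> \<Longrightarrow>
    Comp (hom A B) \<tau> \<sigma> = Cell2 (src2 \<sigma>) (vc A B (body2 \<tau>) (body2 \<sigma>)) (trg2 \<tau>)"
  by (auto simp: hom_def)

lemma category_hom: "category (hom A B)"
  unfolding hom_def
  by (rule category_mk_cat)
    (auto dest: Q_P intro: u2_cell vc_cell vc_assoc intro!: cell2.expand simp: vc_u2_left vc_u2_right)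

lemma hcomp_simps [simp]:
  "P A B F \<Longrightarrow> P B C G \<Longrightarrow> OMap (hcomp A B C) (G, F) = c1 A G F"
  "Q A B (src2 \<sigma>) (trg2 \<sigma>) (body2 \<sigma>) \<Longrightarrow> Q B C (src2 \<tau>) (trg2 \<tau>) (body2 \<tau>) \<Longrightarrow>
    AMap (hcomp A B C) (\<tau>, \<sigma>) = Cell2 (c1 A (src2 \<tau>) (src2 \<sigma>))
      (hc A C (src2 \<tau>) (trg2 \<sigma>) (body2 \<tau>) (body2 \<sigma>)) (c1 A (trg2 \<tau>) (trg2 \<sigma>))"
  by (simp_all add: hcomp_def category_hom)

lemma cat_functor_hcomp: "cat_functor (prod_cat (hom B C) (hom A B)) (hom A C) (hcomp A B C)"
  unfolding hcomp_def
proof (rule cat_functor_mk_ftor, goal_cases)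
  case (4 \<phi> a b)
  then show ?case
    by (cases \<phi>; cases a; cases b) (auto simp: category_hom intro: hc_cell)
next
  \<comment> \<open>Preservation of vertical composites is the interchange law \<open>hc_vc\<close>;
    the tags supply the 1-cells at which it is applied.\<close>
  case (6 \<phi> \<psi> a b c)
  obtain \<tau> \<sigma> \<tau>' \<sigma>' where eq: "\<phi> = (\<tau>, \<sigma>)" "\<psi> = (\<tau>', \<sigma>')"
    by (cases \<phi>; cases \<psi>)
  have Q: "Q A B (src2 \<sigma>) (trg2 \<sigma>) (body2 \<sigma>)" "Q A B (trg2 \<sigma>) (trg2 \<sigma>') (body2 \<sigma>')"
      "Q B C (src2 \<tau>) (trg2 \<tau>) (body2 \<tau>)" "Q B C (trg2 \<tau>) (trg2 \<tau>') (body2 \<tau>')"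
    and src: "src2 \<sigma>' = trg2 \<sigma>" "src2 \<tau>' = trg2 \<tau>"
    using 6 by (cases a; cases b; cases c; auto simp: eq category_hom)+
  then show ?case
    using hc_cell[OF Q(1,3)] hc_cell[OF Q(2,4)] hc_vc[OF Q] by (simp add: eq category_hom)
qed (auto simp: category_hom category_prod_cat c1_cell hc_u2)

text \<open>By \<open>cell2.expand\<close> an equation between tagged 2-cells splits into source
  tags, bodies and target tags. The tags are governed by the laws of \<open>c1\<close>, the bodies
  by those of \<open>hc\<close>.\<close>

theorem two_category: "two_category \<lparr> Cells0 = Ob, HomCat = hom, Unit1 = u1, HComp = hcomp \<rparr>"
  by (rule two_category.intro)
    (auto simp: category_hom cat_functor_hcomp u1_cell u2_cell c1_u1_left c1_u1_right c1_cell c1_assoc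
      hc_u2_left hc_u2_right hc_assoc hc_cell dest: Q_P intro!: cell2.expand c1_assoc)

end

text \<open>Every axiom is universally quantified over 0-cells and asserts the existence of none, so
  it survives restriction to a subclass.\<close>

lemma two_category_full_sub:
  assumes "two_category X"
  shows "two_category (full_sub_two_category X P)"
  using assms unfolding two_category_def full_sub_two_category_def by simp


section \<open>The 2-category of structured display map categories\<close>

lemma dmc_map_fid:
  assumes "display_map_category D"
  shows "dmc_map D D (fid (Under D))"
proof -
  interpret display_map_category D by fact
  have sq: "map_square (AMap (fid (Under D))) s = s" if "is_pullback (Under D) s" for s
    using squaresD[OF pullbackD(1)[OF that]] by (cases s) (auto simp: in_hom_def)
  show ?thesis
    using Disp_arr by (intro dmc_map.intro dmc_map_axioms.intro) (auto simp: assms cat_functor_fid Under_category sq)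
qed

lemma dmc_map_fcomp:
  assumes "dmc_map D D' F" "dmc_map D' D'' G"
  shows "dmc_map D D'' (fcomp (Under D) G F)"
proof -
  interpret F: dmc_map D D' F by fact
  interpret G: dmc_map D' D'' G by fact
  have sq: "map_square (AMap (fcomp (Under D) G F)) s = map_square (AMap G) (map_square (AMap F) s)"
    if "is_pullback (Under D) s" for s
    using squaresD[OF pullbackD(1)[OF that]] by (cases s) (auto simp: in_hom_def)
  have "is_pullback (Under D'') (map_square (AMap G) (map_square (AMap F) s))"
    if "is_pullback (Under D) s" "sq_right s \<in> Disp D" for s
    using that by (intro G.map_pullback F.map_pullback) (simp_all add: square.map_sel F.map_Disp)
  then show ?thesis
    using F.D.Disp_arr by (intro dmc_map.intro dmc_map_axioms.intro)
      (auto simp: F.D.display_map_category_axioms G.D'.display_map_category_axioms cat_functor_fcomp[OF F.map_functor G.map_functor] sq F.map_Disp G.map_Disp subset_iff)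
qed

text \<open>A 2-cell carries no condition beyond naturality, so each law is the corresponding one
  for natural transformations; the two \<open>dmc_map\<close> conjuncts record that the tags are
  1-cells.\<close>

interpretation dmc_cells: tagged_two_cells "{D. display_map_category D}" dmc_map
  "\<lambda>D D' F G \<alpha>. dmc_map D D' F \<and> dmc_map D D' G \<and> nat_trans (Under D) (Under D') F G \<alpha>"
  "\<lambda>D. fid (Under D)" "\<lambda>D D'. nt_id (Under D) (Under D')" "\<lambda>D D'. nt_vcomp (Under D) (Under D')"
  "\<lambda>D. fcomp (Under D)" "\<lambda>D D''. nt_hcomp (Under D) (Under D'')"
  by (rule tagged_two_cells.intro)
    (auto intro: dmc_map_fid dmc_map_fcomp nat_trans_vcomp nat_trans_hcomp
      nt_vcomp_id_right nt_vcomp_id_left nt_vcomp_assoc nt_interchange nt_hcomp_id_left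
      nt_hcomp_id_right nt_hcomp_assoc nat_trans_id[OF dmc_map.map_functor]
      fcomp_fid_left[OF dmc_map.map_functor] fcomp_fid_right[OF dmc_map.map_functor]
      fcomp_assoc[OF dmc_map.map_functor] nt_hcomp_id[OF dmc_map.map_functor dmc_map.map_functor])

lemma dmc_hom_eq: "dmc_cells.hom = dmc_hom"
  by (simp add: fun_eq_iff dmc_cells.hom_def dmc_hom_def)

lemma sDMC_eq: "sDMC = \<lparr> Cells0 = {D. display_map_category D}, HomCat = dmc_cells.hom,
    Unit1 = (\<lambda>D. fid (Under D)), HComp = dmc_cells.hcomp \<rparr>"
  by (simp add: sDMC_def dmc_hom_eq fun_eq_iff dmc_cells.hcomp_def)

lemma two_category_sDMC: "two_category sDMC"
  unfolding sDMC_eq by (rule dmc_cells.two_category)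


section \<open>The 2-category of comprehension categories\<close>

context comprehension_category
begin

lemma Proj_functor: "cat_functor (Total K) (Base K) (Proj K)"
  using fibration by (rule fibration.axioms(1))

lemma category_Base: "category (Base K)"
  using Proj_functor by (rule cat_functor.axioms(2))

lemma category_Total: "category (Total K)"
  using Proj_functor by (rule cat_functor.axioms(1))

lemma Compr_arr_Base: "A \<in> Obj (Total K) \<Longrightarrow> OMap (Compr K) A \<in> Arr (Base K)"
  using cat_functor.OMap_obj[OF Compr_functor] by simp

end

context strict_map
begin

lemma Proj_MTotal:
  "A \<in> Obj (Total K) \<Longrightarrow> OMap (Proj K') (OMap (MTotal M) A) = OMap (MBase M) (OMap (Proj K) A)"
  "\<phi> \<in> Arr (Total K) \<Longrightarrow> AMap (Proj K') (AMap (MTotal M) \<phi>) = AMap (MBase M) (AMap (Proj K) \<phi>)"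
  using fcomp_apply[OF MTotal_over] by blast+

lemma Compr_MTotal:
  "A \<in> Obj (Total K) \<Longrightarrow> OMap (Compr K') (OMap (MTotal M) A) = AMap (MBase M) (OMap (Compr K) A)"
  "\<phi> \<in> Arr (Total K) \<Longrightarrow>
    AMap (Compr K') (AMap (MTotal M) \<phi>) = map_square (AMap (MBase M)) (AMap (Compr K) \<phi>)"
  using fcomp_apply[OF MTotal_Compr] cat_functor.AMap_arr(1)[OF K.Compr_functor]
  by (simp_all add: K.Compr_arr_Base)

text \<open>Strict preservation of context extension. It lets the domain condition of a
  transformation be evaluated at objects in the image of \<open>MTotal M\<close>, as horizontal
  composition requires.\<close>

lemma Dom_Compr_MTotal:
  assumes "A \<in> Obj (Total K)"
  shows "Dom (Base K') (OMap (Compr K') (OMap (MTotal M) A)) =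
    OMap (MBase M) (Dom (Base K) (OMap (Compr K) A))"
  using cat_functor.AMap_arr(2)[OF MBase_functor] assms by (simp add: Compr_MTotal K.Compr_arr_Base)

end

lemma strict_map_id:
  assumes "comprehension_category K"
  shows "strict_map K K (ccmap_id K)"
proof -
  interpret comprehension_category K by fact
  show ?thesis
    by (intro strict_map.intro strict_map_axioms.intro)
      (simp_all add: assms ccmap_id_def cat_functor_fid category_Base category_Total
        fcomp_fid_left[OF Proj_functor] fcomp_fid_right[OF Proj_functor] arrow_functor_fid
        fcomp_fid_left[OF Compr_functor] fcomp_fid_right[OF Compr_functor] cartesian_def)
qed

lemma strict_map_comp:
  assumes "strict_map K K' M" "strict_map K' K'' N"
  shows "strict_map K K'' (ccmap_comp K N M)"
proof -
  interpret M: strict_map K K' M by fact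
  interpret N: strict_map K' K'' N by fact
  have "fcomp (Total K) (Proj K'') (fcomp (Total K) (MTotal N) (MTotal M)) =
      fcomp (Total K) (fcomp (Base K) (MBase N) (MBase M)) (Proj K)"
    using fcomp_assoc[OF M.MTotal_functor] fcomp_assoc[OF M.K.Proj_functor] M.MTotal_over N.MTotal_over
    by metis
  moreover have "fcomp (Total K) (Compr K'') (fcomp (Total K) (MTotal N) (MTotal M)) =
      fcomp (Total K) (arrow_functor (Base K) (fcomp (Base K) (MBase N) (MBase M))) (Compr K)"
    using fcomp_assoc[OF M.MTotal_functor] fcomp_assoc[OF M.K.Compr_functor] M.MTotal_Compr N.MTotal_Compr
      arrow_functor_fcomp[OF M.MBase_functor] by metis
  moreover have "cartesian_in K'' (AMap (fcomp (Total K) (MTotal N) (MTotal M)) \<phi>)" if "cartesian_in K \<phi>" for \<phi>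
    using N.MTotal_cartesian[OF M.MTotal_cartesian[OF that]] that by (simp add: cartesian_def)
  ultimately show ?thesis
    by (intro strict_map.intro strict_map_axioms.intro)
      (simp_all add: ccmap_comp_def cat_functor_fcomp[OF M.MBase_functor N.MBase_functor]
        cat_functor_fcomp[OF M.MTotal_functor N.MTotal_functor]
        M.K.comprehension_category_axioms N.K'.comprehension_category_axioms)
qed

lemma transformation_id:
  assumes "strict_map K K' M"
  shows "transformation K K' M M (cctrans_id K K' M)"
proof -
  interpret strict_map K K' M by fact
  interpret Compr': cat_functor "Total K'" "arrow_cat (Base K')" "Compr K'" by (rule K'.Compr_functor)
  interpret Proj: cat_functor "Total K" "Base K" "Proj K" by (rule K.Proj_functor)
  interpret Proj': cat_functor "Total K'" "Base K'" "Proj K'" by (rule K'.Proj_functor)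
  interpret MT: cat_functor "Total K" "Total K'" "MTotal M" by (rule MTotal_functor)
  show ?thesis
    by (intro transformation.intro transformation_axioms.intro)
      (simp_all add: assms cctrans_id_def nat_trans_id MBase_functor MTotal_functor MT.OMap_obj
        Proj'.AMap_Ident Proj_MTotal Proj.OMap_obj Compr'.AMap_Ident K'.Compr_arr_Base
        Dom_Compr_MTotal K.Compr_arr_Base Proj.B.Dom_obj)
qed

lemma transformation_vcomp:
  assumes "transformation K K' L M \<sigma>" "transformation K K' M N \<tau>"
  shows "transformation K K' L N (cctrans_vcomp K K' \<tau> \<sigma>)"
proof -
  interpret s: transformation K K' L M \<sigma> by fact
  interpret t: transformation K K' M N \<tau> by fact
  interpret Compr': cat_functor "Total K'" "arrow_cat (Base K')" "Compr K'" by (rule s.M.K'.Compr_functor)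
  interpret Proj: cat_functor "Total K" "Base K" "Proj K" by (rule s.M.K.Proj_functor)
  interpret Proj': cat_functor "Total K'" "Base K'" "Proj K'" by (rule s.M.K'.Proj_functor)
  show ?thesis
  proof (intro transformation.intro transformation_axioms.intro)
    fix A
    assume A: "A \<in> Obj (Total K)"
    note st = nat_trans.component_in_hom[OF s.TTotal_nat A] nat_trans.component_in_hom[OF t.TTotal_nat A]
    show "AMap (Proj K') (TTotal (cctrans_vcomp K K' \<tau> \<sigma>) A) =
        TBase (cctrans_vcomp K K' \<tau> \<sigma>) (OMap (Proj K) A)"
      using A Proj'.AMap_Comp[OF st]
      by (simp add: cctrans_vcomp_def s.TTotal_over t.TTotal_over Proj.OMap_obj)
    show "sq_top (AMap (Compr K') (TTotal (cctrans_vcomp K K' \<tau> \<sigma>) A)) =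
        TBase (cctrans_vcomp K K' \<tau> \<sigma>) (Dom (Base K) (OMap (Compr K) A))"
      using A Compr'.AMap_Comp[OF st] Compr'.AMap_in_hom[OF st(1)] Compr'.AMap_in_hom[OF st(2)]
      by (simp add: cctrans_vcomp_def s.TTotal_Compr t.TTotal_Compr s.M.K.Compr_arr_Base Proj.B.Dom_obj)
  qed (simp_all add: cctrans_vcomp_def nat_trans_vcomp[OF s.TBase_nat t.TBase_nat]
      nat_trans_vcomp[OF s.TTotal_nat t.TTotal_nat] s.M.strict_map_axioms t.N.strict_map_axioms)
qed

text \<open>\<open>Compr K''\<close> turns the total component into a composite of squares, whose
  top edge is the composite of the top edges. \<open>Compr_MTotal\<close> rewrites the factor coming
  from \<open>\<sigma>\<close> as the image under \<open>MBase N\<close> of a square whose top edge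
  is known, and \<open>Dom_Compr_MTotal\<close> adjusts the index at which \<open>\<tau>\<close> is
  taken.\<close>

lemma transformation_hcomp:
  assumes "transformation K K' M M' \<sigma>" "transformation K' K'' N N' \<tau>"
  shows "transformation K K'' (ccmap_comp K N M) (ccmap_comp K N' M') (cctrans_hcomp K K'' N M' \<tau> \<sigma>)"
proof -
  interpret s: transformation K K' M M' \<sigma> by fact
  interpret t: transformation K' K'' N N' \<tau> by fact
  interpret Compr': cat_functor "Total K'" "arrow_cat (Base K')" "Compr K'" by (rule s.M.K'.Compr_functor)
  interpret Compr'': cat_functor "Total K''" "arrow_cat (Base K'')" "Compr K''" by (rule t.M.K'.Compr_functor)
  interpret Proj: cat_functor "Total K" "Base K" "Proj K" by (rule s.M.K.Proj_functor)
  interpret Proj': cat_functor "Total K'" "Base K'" "Proj K'" by (rule s.M.K'.Proj_functor)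
  interpret Proj'': cat_functor "Total K''" "Base K''" "Proj K''" by (rule t.M.K'.Proj_functor)
  show ?thesis
  proof (intro transformation.intro transformation_axioms.intro)
    fix A
    assume A: "A \<in> Obj (Total K)"
    have M'A: "OMap (MTotal M') A \<in> Obj (Total K')"
      using cat_functor.OMap_obj[OF s.N.MTotal_functor A] .
    note sA = nat_trans.component_in_hom[OF s.TTotal_nat A]
    note NsA = cat_functor.AMap_in_hom[OF t.M.MTotal_functor sA]
    note tA = nat_trans.component_in_hom[OF t.TTotal_nat M'A]
    have sA_arr: "TTotal \<sigma> A \<in> Arr (Total K')" "AMap (Compr K') (TTotal \<sigma> A) \<in> squares (Base K')"
      using in_homD(1)[OF sA] Compr'.AMap_arr(1) by simp_all
    show "AMap (Proj K'') (TTotal (cctrans_hcomp K K'' N M' \<tau> \<sigma>) A) =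
        TBase (cctrans_hcomp K K'' N M' \<tau> \<sigma>) (OMap (Proj K) A)"
      using A M'A sA_arr Proj''.AMap_Comp[OF NsA tA]
      by (simp add: cctrans_hcomp_def s.TTotal_over t.TTotal_over Proj.OMap_obj t.M.Proj_MTotal s.N.Proj_MTotal)
    show "sq_top (AMap (Compr K'') (TTotal (cctrans_hcomp K K'' N M' \<tau> \<sigma>) A)) =
        TBase (cctrans_hcomp K K'' N M' \<tau> \<sigma>) (Dom (Base K) (OMap (Compr K) A))"
      using A M'A sA_arr Compr''.AMap_Comp[OF NsA tA] Compr''.AMap_in_hom[OF NsA] Compr''.AMap_in_hom[OF tA]
      by (simp add: cctrans_hcomp_def s.TTotal_Compr t.TTotal_Compr s.M.K.Compr_arr_Base Proj.B.Dom_obj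
          t.M.Compr_MTotal(2) s.N.Dom_Compr_MTotal square.map_sel)
  qed (simp_all add: cctrans_hcomp_def ccmap_comp_def nat_trans_hcomp[OF s.TBase_nat t.TBase_nat]
      nat_trans_hcomp[OF s.TTotal_nat t.TTotal_nat]
      strict_map_comp[OF s.M.strict_map_axioms t.M.strict_map_axioms, unfolded ccmap_comp_def]
      strict_map_comp[OF s.N.strict_map_axioms t.N.strict_map_axioms, unfolded ccmap_comp_def])
qed

text \<open>Strict maps and transformations are pairs, so each equational law is checked on the base
  part and on the total part. The case numbers follow the order of the assumptions of
  \<open>tagged_two_cells\<close>.\<close>

interpretation compcat_cells: tagged_two_cells "{K. comprehension_category K}" strict_map transformation
  ccmap_id cctrans_id cctrans_vcomp ccmap_comp cctrans_hcomp
proof (rule tagged_two_cells.intro, goal_cases)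
  case 1
  then show ?case
    by (simp add: transformation.axioms)
next
  case (7 A B F G \<alpha>)
  then interpret transformation A B F G \<alpha> .
  show ?case
    by (simp add: cctrans_vcomp_def cctrans_id_def nt_vcomp_id_right[OF TBase_nat] nt_vcomp_id_right[OF TTotal_nat])
next
  case (8 A B F G \<alpha>)
  then interpret transformation A B F G \<alpha> .
  show ?case
    by (simp add: cctrans_vcomp_def cctrans_id_def nt_vcomp_id_left[OF TBase_nat] nt_vcomp_id_left[OF TTotal_nat])
next
  case (9 A B F G \<alpha> H \<beta> I \<gamma>)
  interpret a: transformation A B F G \<alpha> by fact
  interpret b: transformation A B G H \<beta> by fact
  interpret c: transformation A B H I \<gamma> by fact
  show ?case
    by (simp add: cctrans_vcomp_def nt_vcomp_assoc[OF a.TBase_nat b.TBase_nat c.TBase_nat]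
        nt_vcomp_assoc[OF a.TTotal_nat b.TTotal_nat c.TTotal_nat])
next
  case (10 A B F)
  then interpret strict_map A B F .
  show ?case
    by (simp add: ccmap_comp_def ccmap_id_def fcomp_fid_right[OF MBase_functor] fcomp_fid_right[OF MTotal_functor])
next
  case (11 A B F)
  then interpret strict_map A B F .
  show ?case
    by (simp add: ccmap_comp_def ccmap_id_def fcomp_fid_left[OF MBase_functor] fcomp_fid_left[OF MTotal_functor])
next
  case (12 A B F C G D H)
  then interpret strict_map A B F by blast
  show ?case
    by (simp add: ccmap_comp_def fcomp_assoc[OF MBase_functor] fcomp_assoc[OF MTotal_functor])
next
  case (13 A B F C G)
  interpret F: strict_map A B F by fact
  interpret G: strict_map B C G by fact
  show ?case
    by (simp add: cctrans_hcomp_def cctrans_id_def ccmap_comp_def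
        nt_hcomp_id[OF F.MBase_functor G.MBase_functor] nt_hcomp_id[OF F.MTotal_functor G.MTotal_functor])
next
  case (14 A B F F' \<alpha> F'' \<alpha>' C G G' \<beta> G'' \<beta>')
  interpret a: transformation A B F F' \<alpha> by fact
  interpret a': transformation A B F' F'' \<alpha>' by fact
  interpret b: transformation B C G G' \<beta> by fact
  interpret b': transformation B C G' G'' \<beta>' by fact
  show ?case
    by (simp add: cctrans_hcomp_def cctrans_vcomp_def
        nt_interchange[OF a.TBase_nat a'.TBase_nat b.TBase_nat b'.TBase_nat]
        nt_interchange[OF a.TTotal_nat a'.TTotal_nat b.TTotal_nat b'.TTotal_nat])
next
  case (15 A B F G \<alpha>)
  then interpret transformation A B F G \<alpha> .
  show ?case
    by (simp add: cctrans_hcomp_def ccmap_id_def cctrans_id_def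
        nt_hcomp_id_right[OF TBase_nat] nt_hcomp_id_right[OF TTotal_nat])
next
  case (16 A B F G \<alpha>)
  then interpret transformation A B F G \<alpha> .
  show ?case
    by (simp add: cctrans_hcomp_def ccmap_id_def cctrans_id_def
        nt_hcomp_id_left[OF TBase_nat] nt_hcomp_id_left[OF TTotal_nat])
next
  case (17 A B F F' \<alpha> C G G' \<beta> D H H' \<gamma>)
  interpret a: transformation A B F F' \<alpha> by fact
  interpret b: transformation B C G G' \<beta> by fact
  interpret c: transformation C D H H' \<gamma> by fact
  show ?case
    by (simp add: cctrans_hcomp_def ccmap_comp_def
        nt_hcomp_assoc[OF a.TBase_nat b.TBase_nat c.TBase_nat]
        nt_hcomp_assoc[OF a.TTotal_nat b.TTotal_nat c.TTotal_nat])
qed (auto intro: strict_map_id strict_map_comp transformation_id transformation_vcomp transformation_hcomp)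

lemma compcat_hom_eq: "compcat_cells.hom = compcat_hom"
  by (simp add: fun_eq_iff compcat_cells.hom_def compcat_hom_def)

lemma CompCat_str_eq: "CompCat_str = \<lparr> Cells0 = {K. comprehension_category K}, HomCat = compcat_cells.hom,
    Unit1 = ccmap_id, HComp = compcat_cells.hcomp \<rparr>"
  by (simp add: CompCat_str_def compcat_hom_eq fun_eq_iff compcat_cells.hcomp_def)

lemma two_category_CompCat_str: "two_category CompCat_str"
  unfolding CompCat_str_eq by (rule compcat_cells.two_category)


section \<open>Bijective 2-functors\<close>

definition ftor_inverse :: "('o, 'a) cat \<Rightarrow> ('p, 'b) cat \<Rightarrow> ('o, 'a, 'p, 'b) ftor \<Rightarrow> ('p, 'b, 'o, 'a) ftor" where
  "ftor_inverse A B F = mk_ftor B (inv_into (Obj A) (OMap F)) (inv_into (Arr A) (AMap F))"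

locale bijective_functor = cat_functor A B F
  for A :: "('o, 'a) cat" and B :: "('p, 'b) cat" and F +
  assumes bij_OMap: "bij_betw (OMap F) (Obj A) (Obj B)"
    and bij_AMap: "bij_betw (AMap F) (Arr A) (Arr B)"
begin

abbreviation G :: "('p, 'b, 'o, 'a) ftor" where
  "G \<equiv> ftor_inverse A B F"

lemma inverse_obj:
  assumes "b \<in> Obj B"
  shows "OMap G b \<in> Obj A" "OMap F (OMap G b) = b"
  using assms bij_betw_imp_surj_on[OF bij_OMap]
  by (auto simp: ftor_inverse_def inv_into_into f_inv_into_f)

lemma inverse_arr:
  assumes "g \<in> Arr B"
  shows "AMap G g \<in> Arr A" "AMap F (AMap G g) = g"
  using assms bij_betw_imp_surj_on[OF bij_AMap]
  by (auto simp: ftor_inverse_def inv_into_into f_inv_into_f)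

lemma inverse_left:
  "a \<in> Obj A \<Longrightarrow> OMap G (OMap F a) = a" "f \<in> Arr A \<Longrightarrow> AMap G (AMap F f) = f"
  using bij_OMap bij_AMap
  by (simp_all add: ftor_inverse_def OMap_obj AMap_arr bij_betw_def)

text \<open>\<open>F\<close> preserves domains, so the domain of the preimage of \<open>g\<close> is
  an object sent to \<open>b\<close>; injectivity on objects makes it \<open>OMap G b\<close>. The
  same holds for codomains.\<close>

lemma inverse_in_hom:
  assumes "in_hom B g b c"
  shows "in_hom A (AMap G g) (OMap G b) (OMap G c)"
proof -
  have g: "g \<in> Arr B"
    using in_homD(1)[OF assms] .
  have "OMap F (Dom A (AMap G g)) = b" "OMap F (Cod A (AMap G g)) = c"
    using AMap_arr(2,3)[OF inverse_arr(1)[OF g]] in_homD(2,3)[OF assms] by (simp_all add: inverse_arr(2)[OF g])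
  then show ?thesis
    using inverse_arr(1)[OF g] inverse_left(1)[OF A.Dom_obj] inverse_left(1)[OF A.Cod_obj]
    by (auto simp: in_hom_def)
qed

text \<open>Identities and composites formed in \<open>A\<close> from preimages have the required
  images under \<open>F\<close>; injectivity, in the form of \<open>inverse_left\<close>, then gives
  the equations for \<open>G\<close>.\<close>

lemma cat_functor_inverse: "cat_functor B A G"
proof -
  have "cat_functor B A (mk_ftor B (OMap G) (AMap G))"
  proof (rule cat_functor_mk_ftor)
    show "AMap G (Ident B b) = Ident A (OMap G b)" if "b \<in> Obj B" for b
      using inverse_left(2)[OF in_homD(1)[OF A.Ident_in_hom[OF inverse_obj(1)[OF that]]]]
      by (simp add: AMap_Ident inverse_obj that)
    show "AMap G (Comp B h g) = Comp A (AMap G h) (AMap G g)" if "in_hom B g b c" "in_hom B h c d" for g h b c d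
      using inverse_left(2)[OF in_homD(1)[OF A.Comp_in_hom[OF that[THEN inverse_in_hom]]]]
        AMap_Comp[OF that[THEN inverse_in_hom]]
      by (simp add: inverse_arr(2) in_homD(1)[OF that(1)] in_homD(1)[OF that(2)])
  qed (simp_all add: A.category_axioms B.category_axioms inverse_obj inverse_in_hom)
  then show ?thesis
    by (simp add: ftor_inverse_def mk_ftor_def)
qed

lemma fcomp_inverse_left: "fcomp A G F = fid A"
  by (simp add: fcomp_def fid_def mk_ftor_eq_iff inverse_left)

lemma fcomp_inverse_right: "fcomp B F G = fid B"
  by (simp add: fcomp_def fid_def mk_ftor_eq_iff inverse_obj inverse_arr)

end

text \<open>Each law of the inverse arises from the law of \<Phi> at preimages by cancelling with
  \<open>inverse_left\<close>. The conclusion lists \<open>Y\<close> before \<open>X\<close> because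
  the intended \<Phi> runs from comprehension categories to display map categories.\<close>

lemma (in two_functor) isomorphic_if_bijective:
  assumes bij0: "bij_betw (F0 \<Phi>) (Cells0 X) (Cells0 Y)"
    and bij1: "\<And>A B. A \<in> Cells0 X \<Longrightarrow> B \<in> Cells0 X \<Longrightarrow>
      bij_betw (OMap (FHom \<Phi> A B)) (Obj (HomCat X A B)) (Obj (HomCat Y (F0 \<Phi> A) (F0 \<Phi> B)))"
    and bij2: "\<And>A B. A \<in> Cells0 X \<Longrightarrow> B \<in> Cells0 X \<Longrightarrow>
      bij_betw (AMap (FHom \<Phi> A B)) (Arr (HomCat X A B)) (Arr (HomCat Y (F0 \<Phi> A) (F0 \<Phi> B)))"
  shows "isomorphic_two_categories Y X"
proof -
  \<comment> \<open>Preimages of 0-cells. The hom functors are inverted at \<open>J A\<close> and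
    \<open>J B\<close>, and \<open>bijJ\<close> identifies the target hom category with the one at
    \<open>A\<close> and \<open>B\<close>.\<close>
  define J where "J = inv_into (Cells0 X) (F0 \<Phi>)"
  define \<Psi> where "\<Psi> = \<lparr> F0 = J,
    FHom = (\<lambda>A B. ftor_inverse (HomCat X (J A) (J B)) (HomCat Y A B) (FHom \<Phi> (J A) (J B))) \<rparr>"
  have J: "J A \<in> Cells0 X" "F0 \<Phi> (J A) = A" if "A \<in> Cells0 Y" for A
    using that bij_betw_imp_surj_on[OF bij0] by (auto simp: J_def inv_into_into f_inv_into_f)
  have JF: "J (F0 \<Phi> A) = A" if "A \<in> Cells0 X" for A
    using that bij0 by (simp add: J_def bij_betw_def)
  have bij: "bijective_functor (HomCat X A B) (HomCat Y (F0 \<Phi> A) (F0 \<Phi> B)) (FHom \<Phi> A B)"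
    if "A \<in> Cells0 X" "B \<in> Cells0 X" for A B
    using that by (intro bijective_functor.intro bijective_functor_axioms.intro FHom_functor bij1 bij2)
  have bijJ: "bijective_functor (HomCat X (J A) (J B)) (HomCat Y A B) (FHom \<Phi> (J A) (J B))"
    if "A \<in> Cells0 Y" "B \<in> Cells0 Y" for A B
    using bij[OF J(1)[OF that(1)] J(1)[OF that(2)]] by (simp add: J that)
  have "two_functor Y X \<Psi>"
  proof (intro two_functor.intro two_functor_axioms.intro)
    show "two_category Y" "two_category X"
      by unfold_locales
    show "F0 \<Psi> A \<in> Cells0 X" if "A \<in> Cells0 Y" for A
      using J that by (simp add: \<Psi>_def)
    show "cat_functor (HomCat Y A B) (HomCat X (F0 \<Psi> A) (F0 \<Psi> B)) (FHom \<Psi> A B)"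
      if "A \<in> Cells0 Y" "B \<in> Cells0 Y" for A B
      using bijective_functor.cat_functor_inverse[OF bijJ[OF that]] by (simp add: \<Psi>_def)
    show "OMap (FHom \<Psi> A A) (Unit1 Y A) = Unit1 X (F0 \<Psi> A)" if "A \<in> Cells0 Y" for A
      using bijective_functor.inverse_left(1)[OF bijJ[OF that that] X.Unit1_cell[OF J(1)[OF that]]]
        FHom_Unit1[OF J(1)[OF that]] by (simp add: \<Psi>_def J that)
  next
    fix A B C f g
    assume ABC: "A \<in> Cells0 Y" "B \<in> Cells0 Y" "C \<in> Cells0 Y"
      and f: "f \<in> Obj (HomCat Y A B)" and g: "g \<in> Obj (HomCat Y B C)"
    interpret AB: bijective_functor "HomCat X (J A) (J B)" "HomCat Y A B" "FHom \<Phi> (J A) (J B)"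
      by (rule bijJ[OF ABC(1,2)])
    interpret BC: bijective_functor "HomCat X (J B) (J C)" "HomCat Y B C" "FHom \<Phi> (J B) (J C)"
      by (rule bijJ[OF ABC(2,3)])
    interpret AC: bijective_functor "HomCat X (J A) (J C)" "HomCat Y A C" "FHom \<Phi> (J A) (J C)"
      by (rule bijJ[OF ABC(1,3)])
    note JABC = ABC[THEN J(1)]
    \<comment> \<open>\<open>inverse_left\<close> cancels the hom functor only on genuine 1-cells,
      so the composite formed in \<open>X\<close> must be known to be one.\<close>
    have cell: "OMap (HComp X (J A) (J B) (J C)) (OMap BC.G g, OMap AB.G f) \<in> Obj (HomCat X (J A) (J C))"
      using cat_functor.OMap_obj[OF X.HComp_functor[OF JABC]] AB.inverse_obj[OF f] BC.inverse_obj[OF g]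
      by (simp add: AB.A.category_axioms BC.A.category_axioms)
    show "OMap (FHom \<Psi> A C) (OMap (HComp Y A B C) (g, f)) =
        OMap (HComp X (F0 \<Psi> A) (F0 \<Psi> B) (F0 \<Psi> C)) (OMap (FHom \<Psi> B C) g, OMap (FHom \<Psi> A B) f)"
      using AC.inverse_left(1)[OF cell] FHom_comp1[OF JABC AB.inverse_obj(1)[OF f] BC.inverse_obj(1)[OF g]]
      by (simp add: \<Psi>_def J ABC AB.inverse_obj[OF f] BC.inverse_obj[OF g])
  next
    fix A B C \<sigma> \<tau>
    assume ABC: "A \<in> Cells0 Y" "B \<in> Cells0 Y" "C \<in> Cells0 Y"
      and \<sigma>: "\<sigma> \<in> Arr (HomCat Y A B)" and \<tau>: "\<tau> \<in> Arr (HomCat Y B C)"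
    interpret AB: bijective_functor "HomCat X (J A) (J B)" "HomCat Y A B" "FHom \<Phi> (J A) (J B)"
      by (rule bijJ[OF ABC(1,2)])
    interpret BC: bijective_functor "HomCat X (J B) (J C)" "HomCat Y B C" "FHom \<Phi> (J B) (J C)"
      by (rule bijJ[OF ABC(2,3)])
    interpret AC: bijective_functor "HomCat X (J A) (J C)" "HomCat Y A C" "FHom \<Phi> (J A) (J C)"
      by (rule bijJ[OF ABC(1,3)])
    note JABC = ABC[THEN J(1)]
    have cell: "AMap (HComp X (J A) (J B) (J C)) (AMap BC.G \<tau>, AMap AB.G \<sigma>) \<in> Arr (HomCat X (J A) (J C))"
      using cat_functor.AMap_arr(1)[OF X.HComp_functor[OF JABC]] AB.inverse_arr[OF \<sigma>] BC.inverse_arr[OF \<tau>]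
      by (simp add: AB.A.category_axioms BC.A.category_axioms)
    show "AMap (FHom \<Psi> A C) (AMap (HComp Y A B C) (\<tau>, \<sigma>)) =
        AMap (HComp X (F0 \<Psi> A) (F0 \<Psi> B) (F0 \<Psi> C)) (AMap (FHom \<Psi> B C) \<tau>, AMap (FHom \<Psi> A B) \<sigma>)"
      using AC.inverse_left(2)[OF cell] FHom_comp2[OF JABC AB.inverse_arr(1)[OF \<sigma>] BC.inverse_arr(1)[OF \<tau>]]
      by (simp add: \<Psi>_def J ABC AB.inverse_arr[OF \<sigma>] BC.inverse_arr[OF \<tau>])
  qed
  moreover have "two_functor_left_inverse X \<Psi> \<Phi>"
    using bijective_functor.fcomp_inverse_left[OF bij]
    by (simp add: two_functor_left_inverse_def \<Psi>_def JF)
  moreover have "two_functor_left_inverse Y \<Phi> \<Psi>"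
    using bijective_functor.fcomp_inverse_right[OF bijJ]
    by (simp add: two_functor_left_inverse_def \<Psi>_def J)
  ultimately show ?thesis
    unfolding isomorphic_two_categories_def using two_functor_axioms by blast
qed


section \<open>Cartesian arrows of a full subcategory of the arrow category\<close>

context category
begin

lemma cat_functor_full_arrow_subcat_cod:
  assumes "S \<subseteq> Arr C"
  shows "cat_functor (full_arrow_subcat C S) C (mk_ftor (full_arrow_subcat C S) (Cod C) sq_bot)"
  using assms
  by (intro cat_functor_mk_ftor)
    (auto simp: category_axioms category_full_arrow_subcat subset_iff Cod_obj dest: squaresD(6))

lemma cat_functor_full_arrow_subcat_incl:
  assumes "S \<subseteq> Arr C"
  shows "cat_functor (full_arrow_subcat C S) (arrow_cat C)
    (mk_ftor (full_arrow_subcat C S) (\<lambda>A. A) (\<lambda>\<phi>. \<phi>))"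
  using assms
  by (intro cat_functor_mk_ftor) (auto simp: category_arrow_cat category_full_arrow_subcat)

text \<open>The factorization of \<open>t\<close> over \<open>w\<close> has \<open>w\<close> as
  bottom edge, so only its top edge is to be found: it is the mediating arrow for the cone with legs
  \<open>sq_top t\<close> and \<open>w\<close> after \<open>sq_left t\<close>.\<close>

lemma cartesian_cod_if_pullback:
  assumes S: "S \<subseteq> Arr C" and s: "is_pullback C s" "sq_left s \<in> S" "sq_right s \<in> S"
  shows "cartesian (full_arrow_subcat C S) C (mk_ftor (full_arrow_subcat C S) (Cod C) sq_bot) s"
    (is "cartesian ?T C ?p s")
  unfolding cartesian_def
proof (intro conjI allI impI; (elim conjE)?)
  note sq = pullbackD(1)[OF s(1)]
  note s' = squaresD[OF sq]
  show "s \<in> Arr ?T"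
    using sq s by simp
  fix t w
  assume t: "t \<in> Arr ?T" and cod: "Cod ?T t = Cod ?T s"
    and w: "in_hom C w (OMap ?p (Dom ?T t)) (OMap ?p (Dom ?T s))"
    and sw: "Comp C (AMap ?p s) w = AMap ?p t"
  have tsq: "t \<in> squares C" "sq_left t \<in> S" "sq_right t = sq_right s"
    using t cod sq s by simp_all
  note t' = squaresD[OF tsq(1), unfolded tsq(3)]
  have w': "in_hom C w (Cod C (sq_left t)) (Cod C (sq_left s))" "Comp C (sq_bot s) w = sq_bot t"
    using w sw t tsq sq s by simp_all
  note wt = Comp_in_hom[OF t'(3) w'(1)]
  have "\<exists>!z. in_hom C z (Dom C (sq_left t)) (Dom C (sq_left s)) \<and> Comp C (sq_top s) z = sq_top t
      \<and> Comp C (sq_left s) z = Comp C w (sq_left t)"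
    using Comp_assoc[OF t'(3) w'(1) s'(6)] t'(7) w'(2)
    by (intro pullbackD(2)[OF s(1) t'(5) wt]) simp
  then obtain z where z: "in_hom C z (Dom C (sq_left t)) (Dom C (sq_left s))" "Comp C (sq_top s) z = sq_top t"
      "Comp C (sq_left s) z = Comp C w (sq_left t)"
    by blast
  show "\<exists>!\<theta>. in_hom ?T \<theta> (Dom ?T t) (Dom ?T s) \<and> Comp ?T s \<theta> = t \<and> AMap ?p \<theta> = w"
  proof (rule ex1I[where a = "Square (sq_left t) z w (sq_left s)"], intro conjI)
    have zsq: "Square (sq_left t) z w (sq_left s) \<in> squares C"
      using z w' t'(1) s'(1) by (simp add: squares_def)
    show "in_hom ?T (Square (sq_left t) z w (sq_left s)) (Dom ?T t) (Dom ?T s)"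
      "AMap ?p (Square (sq_left t) z w (sq_left s)) = w"
      using zsq sq s tsq t by simp_all
    show "Comp ?T s (Square (sq_left t) z w (sq_left s)) = t"
      using zsq sq s tsq z w' by (simp add: square.expand)
  next
    fix \<theta>
    assume "in_hom ?T \<theta> (Dom ?T t) (Dom ?T s) \<and> Comp ?T s \<theta> = t \<and> AMap ?p \<theta> = w"
    then have hom: "in_hom ?T \<theta> (Dom ?T t) (Dom ?T s)" and st: "Comp ?T s \<theta> = t" and bot: "AMap ?p \<theta> = w"
      by blast+
    have \<theta>: "\<theta> \<in> squares C" "sq_left \<theta> = sq_left t" "sq_right \<theta> = sq_left s"
      using hom sq s tsq t by simp_all
    then have \<theta>': "sq_bot \<theta> = w"
      using bot s tsq by simp
    have "Comp C (sq_top s) (sq_top \<theta>) = sq_top t"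
      using arg_cong[where f = sq_top, OF st] \<theta> sq s tsq by simp
    moreover have "in_hom C (sq_top \<theta>) (Dom C (sq_left t)) (Dom C (sq_left s))"
      "Comp C (sq_left s) (sq_top \<theta>) = Comp C w (sq_left t)"
      using squaresD(5,7)[OF \<theta>(1)] \<theta> \<theta>' by simp_all
    ultimately have "sq_top \<theta> = z"
      by (metis z pullback_hom_eqI[OF s(1)])
    then show "\<theta> = Square (sq_left t) z w (sq_left s)"
      using \<theta> \<theta>' by (cases \<theta>) simp
  qed
qed

text \<open>The subcategory contains some pullback of the same cospan, and it is isomorphic to the
  given cartesian arrow because both are cartesian lifts.\<close>

lemma pullback_if_cartesian_cod:
  assumes S: "S \<subseteq> Arr C"
    and t: "cartesian (full_arrow_subcat C S) C (mk_ftor (full_arrow_subcat C S) (Cod C) sq_bot) t"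
    and s: "is_pullback C s" "sq_left s \<in> S" "sq_right s = sq_right t" "sq_bot s = sq_bot t"
  shows "is_pullback C t"
proof -
  let ?T = "full_arrow_subcat C S" and ?p = "mk_ftor (full_arrow_subcat C S) (Cod C) sq_bot"
  interpret T: category ?T
    by (rule category_full_arrow_subcat[OF S])
  have lift: "\<exists>!\<theta>. in_hom ?T \<theta> (Dom ?T \<psi>) (Dom ?T t) \<and> Comp ?T t \<theta> = \<psi> \<and> AMap ?p \<theta> = w"
    if "\<psi> \<in> Arr ?T" "Cod ?T \<psi> = Cod ?T t" "in_hom C w (OMap ?p (Dom ?T \<psi>)) (OMap ?p (Dom ?T t))"
      "Comp C (AMap ?p t) w = AMap ?p \<psi>" for \<psi> w
    using t that unfolding cartesian_def by blast
  have t_arr: "t \<in> Arr ?T"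
    using t unfolding cartesian_def by blast
  have tsq: "t \<in> squares C" "sq_left t \<in> S" "sq_right t \<in> S"
    using t_arr by simp_all
  note ssq = pullbackD(1)[OF s(1)]
  note t' = squaresD[OF tsq(1)] and s' = squaresD[OF ssq, unfolded s(3,4)]
  have Cod_eq: "Cod C (sq_left s) = Cod C (sq_left t)"
    using in_homD(2)[OF s'(6)] in_homD(2)[OF t'(6)] by simp
  \<comment> \<open>The two squares share their right and bottom edges, so they are compared over
    the identity of the common codomain of their left edges.\<close>
  let ?i = "Ident C (Cod C (sq_left t))"
  have i: "in_hom C ?i (Cod C (sq_left t)) (Cod C (sq_left t))"
    by (rule Ident_in_hom[OF Cod_obj[OF t'(1)]])
  obtain k where k: "in_hom C k (Dom C (sq_left t)) (Dom C (sq_left s))" "Comp C (sq_top s) k = sq_top t"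
      "Comp C (sq_left s) k = sq_left t"
    using pullbackD(2)[OF s(1), unfolded s(3,4) Cod_eq, OF t'(5,3,7)] by blast
  \<comment> \<open>Cartesianness of \<open>t\<close>, applied to \<open>s\<close> over that
    identity; the top edge of the resulting \<theta> is the comparison \<open>l\<close>.\<close>
  have "\<exists>!\<theta>. in_hom ?T \<theta> (Dom ?T s) (Dom ?T t) \<and> Comp ?T t \<theta> = s \<and> AMap ?p \<theta> = ?i"
    using s ssq tsq i Cod_eq Comp_Ident_right[OF t'(6)] by (intro lift) simp_all
  then obtain \<theta> where "in_hom ?T \<theta> (Dom ?T s) (Dom ?T t)" and t\<theta>: "Comp ?T t \<theta> = s" and "AMap ?p \<theta> = ?i"
    by blast
  then have \<theta>: "\<theta> \<in> squares C" "sq_left \<theta> = sq_left s" "sq_right \<theta> = sq_left t" "sq_bot \<theta> = ?i"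
    using s ssq tsq by auto
  define l where "l = sq_top \<theta>"
  have l: "in_hom C l (Dom C (sq_left s)) (Dom C (sq_left t))" "Comp C (sq_top t) l = sq_top s"
      "Comp C (sq_left t) l = sq_left s"
    using squaresD(5,7)[OF \<theta>(1)] \<theta> arg_cong[where f = sq_top, OF t\<theta>] s tsq Comp_Ident_left[OF s'(3)]
    by (simp_all add: l_def Cod_eq)
  have "Comp C k l = Ident C (Dom C (sq_left s))"
  proof (rule pullback_hom_eqI[OF s(1) Comp_in_hom[OF l(1) k(1)] Ident_in_hom[OF Dom_obj[OF s'(1)]]])
    show "Comp C (sq_top s) (Comp C k l) = Comp C (sq_top s) (Ident C (Dom C (sq_left s)))"
      using Comp_assoc[OF l(1) k(1) s'(5)] Comp_Ident_right[OF s'(5)] k l by simp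
    show "Comp C (sq_left s) (Comp C k l) = Comp C (sq_left s) (Ident C (Dom C (sq_left s)))"
      using Comp_assoc[OF l(1) k(1) s'(3)] Comp_Ident_right[OF s'(3)] k l by simp
  qed
  moreover have "Comp C l k = Ident C (Dom C (sq_left t))"
  proof -
    \<comment> \<open>The pullback property of \<open>t\<close> is not yet available, so this round
      trip is lifted to an endomorphism of \<open>sq_left t\<close> in the subcategory. It and the
      identity both factor \<open>t\<close> through itself over \<open>?i\<close>, hence they are
      equal.\<close>
    let ?lk = "Square (sq_left t) (Comp C l k) ?i (sq_left t)"
    note lk = Comp_in_hom[OF k(1) l(1)]
    have tlk: "Comp C (sq_top t) (Comp C l k) = sq_top t" "Comp C (sq_left t) (Comp C l k) = sq_left t"
      using Comp_assoc[OF k(1) l(1) t'(5)] Comp_assoc[OF k(1) l(1) t'(3)] k l by simp_all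
    have lksq: "?lk \<in> squares C"
      using lk i t' tlk Comp_Ident_left[OF t'(3)] by (simp add: squares_def)
    have idsq: "Square (sq_left t) (Ident C (Dom C (sq_left t))) ?i (sq_left t) \<in> squares C"
      by (rule Ident_square[OF t'(1)])
    have "\<exists>!\<theta>. in_hom ?T \<theta> (Dom ?T t) (Dom ?T t) \<and> Comp ?T t \<theta> = t \<and> AMap ?p \<theta> = ?i"
      using tsq i Comp_Ident_right[OF t'(6)] by (intro lift) simp_all
    moreover have "in_hom ?T ?lk (Dom ?T t) (Dom ?T t) \<and> Comp ?T t ?lk = t \<and> AMap ?p ?lk = ?i"
      using tsq lksq tlk Comp_Ident_right[OF t'(6)] by (simp add: square.expand)
    moreover have "in_hom ?T (Ident ?T (sq_left t)) (Dom ?T t) (Dom ?T t)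
        \<and> Comp ?T t (Ident ?T (sq_left t)) = t \<and> AMap ?p (Ident ?T (sq_left t)) = ?i"
      using tsq idsq t' Comp_Ident_right[OF t'(6)] Comp_Ident_right[OF t'(5)] by (simp add: square.expand)
    ultimately have "?lk = Ident ?T (sq_left t)"
      by blast
    then show ?thesis
      using tsq t' by simp
  qed
  ultimately have "square_isomorphism C s t k l"
    using k l s ssq tsq by (simp add: square_isomorphism_def)
  then show ?thesis
    using s(1) by (rule pullback_square_isomorphism)
qed

end


section \<open>Display map categories as subcategorical comprehension categories\<close>

definition dmc_compcat :: "('o, 'a) dmc \<Rightarrow> ('o, 'a, 'a, 'a square) compcat" where
  "dmc_compcat D =
     \<lparr> Base = Under D, Total = full_arrow_subcat (Under D) (Disp D),
       Proj = mk_ftor (full_arrow_subcat (Under D) (Disp D)) (Cod (Under D)) sq_bot,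
       Compr = mk_ftor (full_arrow_subcat (Under D) (Disp D)) (\<lambda>A. A) (\<lambda>\<phi>. \<phi>) \<rparr>"

definition compcat_dmc :: "('o, 'a, 'a, 'a square) compcat \<Rightarrow> ('o, 'a) dmc" where
  "compcat_dmc K = \<lparr> Under = Base K, Disp = Obj (Total K) \<rparr>"

lemma compcat_dmc_simps [simp]: "Under (compcat_dmc K) = Base K" "Disp (compcat_dmc K) = Obj (Total K)"
  by (simp_all add: compcat_dmc_def)

lemma compcat_dmc_dmc_compcat: "compcat_dmc (dmc_compcat D) = D"
  by (simp add: compcat_dmc_def dmc_compcat_def)

context display_map_category
begin

sublocale Under: category "Under D"
  by (rule Under_category)

text \<open>The pullback axiom of the display structure enters here: it supplies a square on the
  same cospan with left edge in \<open>Disp D\<close>, with which a cartesian arrow can be compared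
  inside the subcategory.\<close>

lemma cartesian_iff_pullback:
  "cartesian_in (dmc_compcat D) \<phi> \<longleftrightarrow> is_pullback (Under D) \<phi> \<and> sq_left \<phi> \<in> Disp D \<and> sq_right \<phi> \<in> Disp D"
proof (intro iffI conjI)
  assume cart: "cartesian_in (dmc_compcat D) \<phi>"
  then have \<phi>: "\<phi> \<in> squares (Under D)" "sq_left \<phi> \<in> Disp D" "sq_right \<phi> \<in> Disp D"
    by (simp_all add: cartesian_def dmc_compcat_def)
  then show "sq_left \<phi> \<in> Disp D" "sq_right \<phi> \<in> Disp D"
    by blast+
  obtain s where s: "is_pullback (Under D) s" "sq_right s = sq_right \<phi>" "sq_bot s = sq_bot \<phi>" "sq_left s \<in> Disp D"
    using Disp_pullback[OF \<phi>(3) in_homD(1,3)[OF squaresD(6)[OF \<phi>(1)]]] by blast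
  show "is_pullback (Under D) \<phi>"
    using Under.pullback_if_cartesian_cod[OF Disp_arr _ s(1,4,2,3)] cart by (simp add: dmc_compcat_def)
qed (simp add: dmc_compcat_def Under.cartesian_cod_if_pullback[OF Disp_arr])

text \<open>The pullback squares provided by \<open>Disp_pullback\<close> are the cartesian lifts.
  Fullness holds because every square between display maps is an arrow of the total
  category.\<close>

lemma subcategorical_dmc_compcat: "subcategorical_comprehension_category (dmc_compcat D)"
proof (intro subcategorical_comprehension_category.intro subcategorical_comprehension_category_axioms.intro
    full_comprehension_category.intro full_comprehension_category_axioms.intro
    comprehension_category.intro fibration.intro fibration_axioms.intro)
  show "cat_functor (Total (dmc_compcat D)) (Base (dmc_compcat D)) (Proj (dmc_compcat D))"
    by (simp add: dmc_compcat_def Under.cat_functor_full_arrow_subcat_cod[OF Disp_arr])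
  show "cat_functor (Total (dmc_compcat D)) (arrow_cat (Base (dmc_compcat D))) (Compr (dmc_compcat D))"
    by (simp add: dmc_compcat_def Under.cat_functor_full_arrow_subcat_incl[OF Disp_arr])
  show "\<exists>\<phi>. cartesian_in (dmc_compcat D) \<phi> \<and> Cod (Total (dmc_compcat D)) \<phi> = A \<and> AMap (Proj (dmc_compcat D)) \<phi> = f"
    if A: "A \<in> Obj (Total (dmc_compcat D))" and f: "f \<in> Arr (Base (dmc_compcat D))"
      and cod: "Cod (Base (dmc_compcat D)) f = OMap (Proj (dmc_compcat D)) A" for A f
  proof -
    have "A \<in> Disp D" "f \<in> Arr (Under D)" "Cod (Under D) f = Cod (Under D) A"
      using A f cod by (simp_all add: dmc_compcat_def)
    then obtain s where s: "is_pullback (Under D) s" "sq_right s = A" "sq_bot s = f" "sq_left s \<in> Disp D"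
      using Disp_pullback by blast
    have "cartesian_in (dmc_compcat D) s"
      using s \<open>A \<in> Disp D\<close> by (simp add: cartesian_iff_pullback)
    then show ?thesis
      using s pullbackD(1)[OF s(1)] \<open>A \<in> Disp D\<close> by (intro exI[of _ s]) (simp add: dmc_compcat_def)
  qed
  show "is_pullback (Base (dmc_compcat D)) (AMap (Compr (dmc_compcat D)) \<phi>)" if "cartesian_in (dmc_compcat D) \<phi>" for \<phi>
    using that pullbackD(1)[of "Under D" \<phi>] unfolding cartesian_iff_pullback by (simp add: dmc_compcat_def)
  show "fcomp (Total (dmc_compcat D)) (cod_functor (Base (dmc_compcat D))) (Compr (dmc_compcat D)) = Proj (dmc_compcat D)"
    using Disp_arr by (simp add: dmc_compcat_def fcomp_def mk_ftor_eq_iff subset_iff)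
  show "full_functor (Total (dmc_compcat D)) (arrow_cat (Base (dmc_compcat D))) (Compr (dmc_compcat D))"
    unfolding full_functor_def
  proof (intro ballI allI impI)
    fix a b g
    assume "a \<in> Obj (Total (dmc_compcat D))" "b \<in> Obj (Total (dmc_compcat D))"
      "in_hom (arrow_cat (Base (dmc_compcat D))) g (OMap (Compr (dmc_compcat D)) a) (OMap (Compr (dmc_compcat D)) b)"
    then show "\<exists>f. in_hom (Total (dmc_compcat D)) f a b \<and> AMap (Compr (dmc_compcat D)) f = g"
      by (intro exI[of _ g]) (simp add: dmc_compcat_def)
  qed
  show "faithful_functor (Total (dmc_compcat D)) (Compr (dmc_compcat D))"
    by (auto simp: dmc_compcat_def faithful_functor_def)
qed (simp_all add: dmc_compcat_def)

end

section \<open>Reconstruction of a subcategorical comprehension category from its base and its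
  display maps\<close>

context subcategorical_comprehension_category
begin

lemma Obj_Total_arr: "Obj (Total K) \<subseteq> Arr (Base K)"
  using Compr_arr_Base by (auto simp: Compr_obj)

text \<open>Left to right, the inclusion is a functor into the arrow category. Right to left,
  fullness yields some arrow over the square, and \<open>Compr_arr\<close> makes that arrow the
  square itself.\<close>

lemma in_hom_Total:
  "in_hom (Total K) \<phi> A B \<longleftrightarrow> \<phi> \<in> squares (Base K) \<and> sq_left \<phi> = A \<and> sq_right \<phi> = B
    \<and> A \<in> Obj (Total K) \<and> B \<in> Obj (Total K)" (is "_ \<longleftrightarrow> ?R")
proof
  interpret T: category "Total K" by (rule category_Total)
  assume h: "in_hom (Total K) \<phi> A B"
  show ?R
    using cat_functor.AMap_in_hom[OF Compr_functor h] T.in_hom_obj[OF h] in_homD(1)[OF h]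
    by (simp add: Compr_obj Compr_arr)
next
  assume R: ?R
  then have "in_hom (arrow_cat (Base K)) \<phi> (OMap (Compr K) A) (OMap (Compr K) B)"
    by (simp add: Compr_obj)
  then obtain \<phi>' where "in_hom (Total K) \<phi>' A B" "AMap (Compr K) \<phi>' = \<phi>"
    using Compr_full R unfolding full_functor_def by blast
  then show "in_hom (Total K) \<phi> A B"
    using Compr_arr[OF in_homD(1)] by metis
qed

lemma Total_arr_iff:
  "\<phi> \<in> Arr (Total K) \<longleftrightarrow> \<phi> \<in> squares (Base K) \<and> sq_left \<phi> \<in> Obj (Total K) \<and> sq_right \<phi> \<in> Obj (Total K)"
  by (metis in_hom_Total in_hom_def)

text \<open>The inclusion acts as the identity on arrows, so its preservation of identities and
  composites says that those of \<open>Total K\<close> are the ones of the arrow category.\<close>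

lemma Total_eq: "Total K = full_arrow_subcat (Base K) (Obj (Total K))"
proof (rule full_arrow_subcat_eqI[OF category_Total category_Base Obj_Total_arr])
  interpret T: category "Total K" by (rule category_Total)
  interpret Compr: cat_functor "Total K" "arrow_cat (Base K)" "Compr K" by (rule Compr_functor)
  show DC: "Dom (Total K) s = sq_left s" "Cod (Total K) s = sq_right s" if "s \<in> Arr (Total K)" for s
    using that in_hom_Total[of s "Dom (Total K) s" "Cod (Total K) s"] by (auto simp: in_hom_def)
  show "Ident (Total K) f = Ident (arrow_cat (Base K)) f" if "f \<in> Obj (Total K)" for f
    using Compr.AMap_Ident[OF that] Compr_arr[OF in_homD(1)[OF T.Ident_in_hom[OF that]]] that
    by (simp add: Compr_obj)
  show "Comp (Total K) t s = Comp (arrow_cat (Base K)) t s"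
    if "s \<in> Arr (Total K)" "t \<in> Arr (Total K)" "Dom (Total K) t = Cod (Total K) s" for s t
  proof -
    have st: "in_hom (Total K) s (sq_left s) (sq_right s)" "in_hom (Total K) t (sq_right s) (sq_right t)"
      using that DC by (simp_all add: in_hom_def)
    show ?thesis
      using Compr.AMap_Comp[OF st] Compr_arr[OF in_homD(1)[OF T.Comp_in_hom[OF st]]] that
      by (simp add: Compr_arr)
  qed
qed (rule Total_arr_iff)

lemma Compr_eq: "Compr K = mk_ftor (Total K) (\<lambda>A. A) (\<lambda>\<phi>. \<phi>)"
  by (subst cat_functor_eq_mk_ftor[OF Compr_functor]) (simp add: mk_ftor_eq_iff Compr_obj Compr_arr)

text \<open>Forced by the strict equation \<open>cod_Compr\<close>, since the comprehension functor
  is an inclusion.\<close>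

lemma Proj_eq: "Proj K = mk_ftor (Total K) (Cod (Base K)) sq_bot"
  unfolding cod_Compr[symmetric] fcomp_def
  using Obj_Total_arr by (auto simp: mk_ftor_eq_iff Compr_obj Compr_arr Total_arr_iff)

lemma dmc_compcat_compcat_dmc: "dmc_compcat (compcat_dmc K) = K"
  by (rule compcat.equality)
    (simp_all add: dmc_compcat_def Total_eq[symmetric] Compr_eq[symmetric] Proj_eq[symmetric])

text \<open>A cartesian lift of \<open>f\<close> at \<open>d\<close> is itself a square with right
  edge \<open>d\<close> and bottom edge \<open>f\<close>; its left edge is its domain in the total
  category, hence a display map.\<close>

lemma display_map_category_compcat_dmc: "display_map_category (compcat_dmc K)"
proof (rule display_map_category.intro)
  show "category (Under (compcat_dmc K))" "Disp (compcat_dmc K) \<subseteq> Arr (Under (compcat_dmc K))"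
    by (simp_all add: category_Base Obj_Total_arr)
  fix d f
  assume d: "d \<in> Disp (compcat_dmc K)" and f: "f \<in> Arr (Under (compcat_dmc K))"
    and cod: "Cod (Under (compcat_dmc K)) f = Cod (Under (compcat_dmc K)) d"
  then obtain \<phi> where \<phi>: "cartesian_in K \<phi>" "Cod (Total K) \<phi> = d" "AMap (Proj K) \<phi> = f"
    using fibration.cartesian_lift[OF fibration, of d f] by (auto simp: Proj_eq)
  have arr: "\<phi> \<in> Arr (Total K)"
    using \<phi>(1) by (simp add: cartesian_def)
  then have "in_hom (Total K) \<phi> (Dom (Total K) \<phi>) d"
    using \<phi>(2) by (simp add: in_hom_def)
  moreover have "sq_bot \<phi> = f"
    using \<phi>(3) arr by (simp add: Proj_eq)
  ultimately show "\<exists>s. is_pullback (Under (compcat_dmc K)) s \<and> sq_right s = d \<and> sq_bot s = f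
      \<and> sq_left s \<in> Disp (compcat_dmc K)"
    using Compr_cartesian[OF \<phi>(1)] Compr_arr[OF arr] by (auto simp: in_hom_Total)
qed

sublocale dmc: display_map_category "compcat_dmc K"
  by (rule display_map_category_compcat_dmc)

lemma cartesian_in_iff_pullback:
  "cartesian_in K \<phi> \<longleftrightarrow> is_pullback (Base K) \<phi> \<and> sq_left \<phi> \<in> Obj (Total K) \<and> sq_right \<phi> \<in> Obj (Total K)"
  using dmc.cartesian_iff_pullback by (simp add: dmc_compcat_compcat_dmc)

end

lemma bij_betw_compcat_dmc:
  "bij_betw compcat_dmc {K. subcategorical_comprehension_category K} {D. display_map_category D}"
  by (rule bij_betwI[where g = dmc_compcat])
    (auto simp: compcat_dmc_dmc_compcat subcategorical_comprehension_category.dmc_compcat_compcat_dmc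
      intro: subcategorical_comprehension_category.display_map_category_compcat_dmc
        display_map_category.subcategorical_dmc_compcat)


section \<open>1-cells and 2-cells between subcategorical comprehension categories\<close>

text \<open>The total part is the arrow functor of \<open>F\<close> cut down to the display maps,
  the only choice compatible with both inclusions.\<close>

definition square_ccmap :: "('o, 'a, 'a, 'a square) compcat \<Rightarrow> ('o, 'a, 'p, 'b) ftor \<Rightarrow>
    ('o, 'a, 'a, 'a square, 'p, 'b, 'b, 'b square) ccmap" where
  "square_ccmap K F = \<lparr> MBase = F, MTotal = mk_ftor (Total K) (AMap F) (map_square (AMap F)) \<rparr>"

text \<open>The component at \<open>A\<close> is the naturality square of \<alpha> at the arrow
  \<open>A\<close>.\<close>

definition square_cctrans :: "('o, 'a, 'a, 'a square) compcat \<Rightarrow> ('o, 'a, 'p, 'b) ftor \<Rightarrow> ('o, 'a, 'p, 'b) ftor \<Rightarrow>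
    ('o \<Rightarrow> 'b) \<Rightarrow> ('o, 'b, 'a, 'b square) cctrans" where
  "square_cctrans K F G \<alpha> = \<lparr> TBase = \<alpha>, TTotal = (\<lambda>A\<in>Obj (Total K).
     Square (AMap F A) (\<alpha> (Dom (Base K) A)) (\<alpha> (Cod (Base K) A)) (AMap G A)) \<rparr>"

locale subcategorical_pair = K: subcategorical_comprehension_category K + K': subcategorical_comprehension_category K'
  for K :: "('o, 'a, 'a, 'a square) compcat" and K' :: "('p, 'b, 'b, 'b square) compcat"
begin

lemma strict_map_eq_square_ccmap:
  assumes "strict_map K K' M"
  shows "M = square_ccmap K (MBase M)"
proof -
  interpret strict_map K K' M by fact
  interpret MT: cat_functor "Total K" "Total K'" "MTotal M" by (rule MTotal_functor)
  have "MTotal M = mk_ftor (Total K) (AMap (MBase M)) (map_square (AMap (MBase M)))"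
    by (subst cat_functor_eq_mk_ftor[OF MTotal_functor])
      (use Compr_MTotal in \<open>auto simp: mk_ftor_eq_iff K.Compr_eq K'.Compr_eq MT.OMap_obj MT.AMap_arr\<close>)
  then show ?thesis
    by (simp add: square_ccmap_def)
qed

text \<open>The left edge of the given pullback \<open>s\<close> may lie outside the display class,
  where the strict map gives no direct information. So \<open>s\<close> is replaced by a pullback
  \<open>t\<close> of the same cospan with display left edge; \<open>t\<close> is cartesian, its
  image is a pullback, and the isomorphism of \<open>t\<close> with \<open>s\<close> carries this
  over to the image of \<open>s\<close>.\<close>

lemma dmc_map_MBase:
  assumes "strict_map K K' M"
  shows "dmc_map (compcat_dmc K) (compcat_dmc K') (MBase M)"
proof -
  interpret strict_map K K' M by fact
  interpret MT: cat_functor "Total K" "Total K'" "MTotal M" by (rule MTotal_functor)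
  have MT_eq: "MTotal M = mk_ftor (Total K) (AMap (MBase M)) (map_square (AMap (MBase M)))"
    using strict_map_eq_square_ccmap[OF assms] by (metis ccmap.select_convs(2) square_ccmap_def)
  show ?thesis
  proof (intro dmc_map.intro dmc_map_axioms.intro)
    show "AMap (MBase M) d \<in> Disp (compcat_dmc K')" if "d \<in> Disp (compcat_dmc K)" for d
      using MT.OMap_obj that by (simp add: MT_eq)
    fix s
    assume s: "is_pullback (Under (compcat_dmc K)) s" and "sq_right s \<in> Disp (compcat_dmc K)"
    then obtain t where t: "is_pullback (Base K) t" "sq_right t = sq_right s" "sq_bot t = sq_bot s"
        "sq_left t \<in> Obj (Total K)" and d: "sq_right s \<in> Obj (Total K)"
      using K.dmc.Disp_pullback in_homD(1,3)[OF squaresD(6)[OF pullbackD(1)[OF s]]] by auto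
    have cart: "cartesian_in K t"
      using t d by (simp add: K.cartesian_in_iff_pullback)
    then have "cartesian_in K' (map_square (AMap (MBase M)) t)"
      using MTotal_cartesian[OF cart] by (simp add: MT_eq cartesian_def)
    then have "is_pullback (Base K') (map_square (AMap (MBase M)) t)"
      by (simp add: K'.cartesian_in_iff_pullback)
    moreover obtain k l where "square_isomorphism (Base K) t s k l"
      using category.pullback_unique[OF K.category_Base t(1) _ t(2,3)] s by auto
    ultimately show "is_pullback (Under (compcat_dmc K')) (map_square (AMap (MBase M)) s)"
      using square_isomorphism_map[OF MBase_functor] category.pullback_square_isomorphism[OF K'.category_Base]
      by (metis compcat_dmc_simps(1))
  qed (simp_all add: MBase_functor K.dmc.display_map_category_axioms K'.dmc.display_map_category_axioms)
qed

text \<open>The functor laws are inherited from the arrow functor. A cartesian arrow is a pullback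
  square with display right edge, so \<open>map_pullback\<close> applies to it, and
  \<open>map_Disp\<close> keeps its left and right edges in the display class.\<close>

lemma strict_map_square_ccmap:
  assumes "dmc_map (compcat_dmc K) (compcat_dmc K') F"
  shows "strict_map K K' (square_ccmap K F)"
proof -
  interpret dmc_map "compcat_dmc K" "compcat_dmc K'" F by fact
  interpret F: cat_functor "Base K" "Base K'" F
    using map_functor by simp
  interpret aF: cat_functor "arrow_cat (Base K)" "arrow_cat (Base K')" "arrow_functor (Base K) F"
    by (rule F.cat_functor_arrow)
  have obj: "AMap F A \<in> Obj (Total K')" if "A \<in> Obj (Total K)" for A
    using map_Disp that by simp
  have arr: "A \<in> Arr (Base K)" if "A \<in> Obj (Total K)" for A
    using K.Obj_Total_arr that by blast
  have "cat_functor (Total K) (Total K') (mk_ftor (Total K) (AMap F) (map_square (AMap F)))"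
  proof (rule cat_functor_mk_ftor)
    show "map_square (AMap F) (Ident (Total K) A) = Ident (Total K') (AMap F A)" if "A \<in> Obj (Total K)" for A
      using aF.AMap_Ident[of A] that obj[OF that] arr[OF that] F.A.Ident_square[OF arr[OF that]]
      by (subst K.Total_eq, subst K'.Total_eq) simp
    show "map_square (AMap F) (Comp (Total K) t s) = Comp (Total K') (map_square (AMap F) t) (map_square (AMap F) s)"
      if "in_hom (Total K) s A B" "in_hom (Total K) t B C" for s t A B C
      using that aF.AMap_Comp[of s A B t C] F.A.Comp_square[of s t]
      by (subst K.Total_eq, subst K'.Total_eq)
        (auto simp: K.in_hom_Total F.map_square_squares square.map_sel obj)
  qed (auto simp: K.category_Total K'.category_Total obj K.in_hom_Total K'.in_hom_Total
      F.map_square_squares square.map_sel)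
  moreover have "cartesian_in K' (AMap (mk_ftor (Total K) (AMap F) (map_square (AMap F))) \<phi>)"
    if "cartesian_in K \<phi>" for \<phi>
    using that map_pullback[of \<phi>] obj pullbackD(1)[of "Base K" \<phi>]
    by (auto simp: K.cartesian_in_iff_pullback K'.cartesian_in_iff_pullback K.Total_arr_iff square.map_sel)
  ultimately show ?thesis
    by (intro strict_map.intro strict_map_axioms.intro)
      (auto simp: K.comprehension_category_axioms K'.comprehension_category_axioms square_ccmap_def
        F.cat_functor_axioms fcomp_def mk_ftor_eq_iff K.Compr_eq K'.Compr_eq K.Proj_eq K'.Proj_eq obj arr
        K.Total_arr_iff K'.Total_arr_iff F.map_square_squares square.map_sel F.AMap_arr)
qed

lemma bij_betw_MBase:
  "bij_betw MBase {M. strict_map K K' M} {F. dmc_map (compcat_dmc K) (compcat_dmc K') F}"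
proof (rule bij_betwI[where g = "square_ccmap K"])
  show "square_ccmap K (MBase M) = M" if "M \<in> {M. strict_map K K' M}" for M
    using strict_map_eq_square_ccmap that by auto
  show "MBase (square_ccmap K F) = F" for F
    by (simp add: square_ccmap_def)
qed (auto intro: dmc_map_MBase strict_map_square_ccmap)

text \<open>The left and right edges of a component are fixed too: they are its source and target in
  the total category, which \<open>Compr_MTotal\<close> computes.\<close>

lemma transformation_eq_square_cctrans:
  assumes "transformation K K' M N \<tau>"
  shows "\<tau> = square_cctrans K (MBase M) (MBase N) (TBase \<tau>)"
proof -
  interpret transformation K K' M N \<tau> by fact
  interpret T: nat_trans "Total K" "Total K'" "MTotal M" "MTotal N" "TTotal \<tau>" by (rule TTotal_nat)
  have "TTotal \<tau> A = Square (AMap (MBase M) A) (TBase \<tau> (Dom (Base K) A)) (TBase \<tau> (Cod (Base K) A)) (AMap (MBase N) A)"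
    if A: "A \<in> Obj (Total K)" for A
    using T.component_in_hom[OF A] T.component_arr(1)[OF A] A M.Compr_MTotal(1)[OF A] N.Compr_MTotal(1)[OF A]
      TTotal_over[OF A] TTotal_Compr[OF A]
    by (cases "TTotal \<tau> A") (simp add: K'.in_hom_Total K.Compr_eq K'.Compr_eq K.Proj_eq K'.Proj_eq)
  then have "TTotal \<tau> = (\<lambda>A\<in>Obj (Total K). Square (AMap (MBase M) A) (TBase \<tau> (Dom (Base K) A))
      (TBase \<tau> (Cod (Base K) A)) (AMap (MBase N) A))"
    using T.component_ext by (intro extensionalityI[of _ "Obj (Total K)"]) simp_all
  then show ?thesis
    by (simp add: square_cctrans_def)
qed

text \<open>Naturality of the total part at a square \<phi> is an equation of squares. Its top and
  bottom edges are naturality of \<alpha> at \<open>sq_top \<phi>\<close> and at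
  \<open>sq_bot \<phi>\<close>.\<close>

lemma transformation_square_cctrans:
  assumes "strict_map K K' M" "strict_map K K' N"
    and \<alpha>: "nat_trans (Base K) (Base K') (MBase M) (MBase N) \<alpha>"
  shows "transformation K K' M N (square_cctrans K (MBase M) (MBase N) \<alpha>)"
proof -
  interpret M: strict_map K K' M by fact
  interpret N: strict_map K K' N by fact
  interpret \<alpha>: nat_trans "Base K" "Base K'" "MBase M" "MBase N" \<alpha> by fact
  have MT: "MTotal L = mk_ftor (Total K) (AMap (MBase L)) (map_square (AMap (MBase L)))" if "strict_map K K' L" for L
    using strict_map_eq_square_ccmap[OF that] by (metis ccmap.select_convs(2) square_ccmap_def)
  have arr: "A \<in> Arr (Base K)" if "A \<in> Obj (Total K)" for A
    using K.Obj_Total_arr that by blast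
  let ?t = "\<lambda>A. Square (AMap (MBase M) A) (\<alpha> (Dom (Base K) A)) (\<alpha> (Cod (Base K) A)) (AMap (MBase N) A)"
  have t_sq: "?t A \<in> squares (Base K')" if "A \<in> Arr (Base K)" for A
    using that \<alpha>.component_in_hom[OF \<alpha>.F.A.Dom_obj[OF that]] \<alpha>.component_in_hom[OF \<alpha>.F.A.Cod_obj[OF that]]
      \<alpha>.naturality[of A "Dom (Base K) A" "Cod (Base K) A"]
    by (simp add: squares_def \<alpha>.F.AMap_arr \<alpha>.G.AMap_arr in_hom_def)
  have obj: "AMap (MBase M) A \<in> Obj (Total K')" "AMap (MBase N) A \<in> Obj (Total K')" if "A \<in> Obj (Total K)" for A
    using cat_functor.OMap_obj[OF M.MTotal_functor that] cat_functor.OMap_obj[OF N.MTotal_functor that] that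
    by (simp_all add: MT assms)
  have t: "in_hom (Total K') (?t A) (OMap (MTotal M) A) (OMap (MTotal N) A)" if "A \<in> Obj (Total K)" for A
    using t_sq[OF arr[OF that]] obj[OF that] that by (simp add: K'.in_hom_Total MT assms)
  have "nat_trans (Total K) (Total K') (MTotal M) (MTotal N) (restrict ?t (Obj (Total K)))"
  proof (rule nat_trans_restrictI[OF M.MTotal_functor N.MTotal_functor t])
    fix \<phi> A B
    assume \<phi>: "in_hom (Total K) \<phi> A B"
    then have sq: "\<phi> \<in> squares (Base K)" and AB: "sq_left \<phi> = A" "sq_right \<phi> = B" "A \<in> Obj (Total K)" "B \<in> Obj (Total K)"
      by (simp_all add: K.in_hom_Total)
    note \<phi>' = squaresD[OF sq, unfolded AB(1,2)]
    show "Comp (Total K') (?t B) (AMap (MTotal M) \<phi>) = Comp (Total K') (AMap (MTotal N) \<phi>) (?t A)"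
      using \<alpha>.naturality[OF \<phi>'(5)] \<alpha>.naturality[OF \<phi>'(6)] t_sq[OF \<phi>'(1)] t_sq[OF \<phi>'(2)]
        \<alpha>.F.map_square_squares[OF sq] \<alpha>.G.map_square_squares[OF sq] obj[OF AB(3)] obj[OF AB(4)] AB sq
        in_homD(1)[OF \<phi>]
      by (subst (1 2) K'.Total_eq) (simp add: MT assms square.map_sel)
  qed
  moreover have "AMap (Proj K') (?t A) = \<alpha> (OMap (Proj K) A)" "sq_top (AMap (Compr K') (?t A)) = \<alpha> (Dom (Base K) (OMap (Compr K) A))"
    if "A \<in> Obj (Total K)" for A
    using that in_homD(1)[OF t[OF that]] by (simp_all add: K.Compr_eq K'.Compr_eq K.Proj_eq K'.Proj_eq)
  ultimately show ?thesis
    using assms by (intro transformation.intro transformation_axioms.intro) (simp_all add: square_cctrans_def)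
qed

end


section \<open>The forgetful 2-functor\<close>

definition forget_hom :: "('o, 'a, 'a, 'a square) compcat \<Rightarrow> ('o, 'a, 'a, 'a square) compcat \<Rightarrow>
    (('o, 'a, 'a, 'a square, 'o, 'a, 'a, 'a square) ccmap,
     (('o, 'a, 'a, 'a square, 'o, 'a, 'a, 'a square) ccmap, ('o, 'a, 'a, 'a square) cctrans) cell2,
     ('o, 'a, 'o, 'a) ftor, (('o, 'a, 'o, 'a) ftor, 'o \<Rightarrow> 'a) cell2) ftor" where
  "forget_hom K K' = mk_ftor (compcat_cells.hom K K') MBase
     (\<lambda>\<sigma>. Cell2 (MBase (src2 \<sigma>)) (TBase (body2 \<sigma>)) (MBase (trg2 \<sigma>)))"

lemma CompCat_str_sub_simps [simp]:
  "K \<in> Cells0 CompCat_str_sub \<longleftrightarrow> subcategorical_comprehension_category K"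
  "HomCat CompCat_str_sub = compcat_cells.hom" "Unit1 CompCat_str_sub = ccmap_id" "HComp CompCat_str_sub = compcat_cells.hcomp"
  by (auto simp: CompCat_str_sub_def full_sub_two_category_def CompCat_str_eq
      subcategorical_comprehension_category_def full_comprehension_category_def)

lemma sDMC_simps [simp]:
  "D \<in> Cells0 sDMC \<longleftrightarrow> display_map_category D"
  "HomCat sDMC = dmc_cells.hom" "Unit1 sDMC = (\<lambda>D. fid (Under D))" "HComp sDMC = dmc_cells.hcomp"
  by (simp_all add: sDMC_eq)

lemma forget_hom_simps [simp]:
  "strict_map K K' M \<Longrightarrow> OMap (forget_hom K K') M = MBase M"
  "transformation K K' (src2 \<sigma>) (trg2 \<sigma>) (body2 \<sigma>) \<Longrightarrow> AMap (forget_hom K K') \<sigma> =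
    Cell2 (MBase (src2 \<sigma>)) (TBase (body2 \<sigma>)) (MBase (trg2 \<sigma>))"
  by (simp_all add: forget_hom_def)

context subcategorical_pair
begin

lemma dmc_cell_if_transformation:
  assumes "transformation K K' M N \<tau>"
  shows "dmc_map (compcat_dmc K) (compcat_dmc K') (MBase M)" "dmc_map (compcat_dmc K) (compcat_dmc K') (MBase N)"
    "nat_trans (Base K) (Base K') (MBase M) (MBase N) (TBase \<tau>)"
  using assms dmc_map_MBase by (auto simp: transformation_def transformation_axioms_def)

end

lemma cat_functor_forget_hom:
  fixes K K' :: "('o, 'a, 'a, 'a square) compcat"
  assumes "subcategorical_pair K K'"
  shows "cat_functor (compcat_cells.hom K K') (dmc_cells.hom (compcat_dmc K) (compcat_dmc K')) (forget_hom K K')"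
proof -
  interpret subcategorical_pair K K' by fact
  show ?thesis
    unfolding forget_hom_def
  proof (rule cat_functor_mk_ftor, goal_cases)
    case (6 \<sigma> \<tau> M N L)
    then have "transformation K K' M N (body2 \<sigma>)" "transformation K K' N L (body2 \<tau>)"
      by simp_all
    with 6 show ?case
      using dmc_cell_if_transformation by (auto simp: cctrans_vcomp_def)
  qed (auto simp: compcat_cells.category_hom dmc_cells.category_hom dmc_map_MBase dmc_cell_if_transformation cctrans_id_def)
qed

lemma bij_betw_forget_hom:
  fixes K K' :: "('o, 'a, 'a, 'a square) compcat"
  assumes "subcategorical_pair K K'"
  shows "bij_betw (OMap (forget_hom K K')) (Obj (compcat_cells.hom K K')) (Obj (dmc_cells.hom (compcat_dmc K) (compcat_dmc K')))"
    and "bij_betw (AMap (forget_hom K K')) (Arr (compcat_cells.hom K K')) (Arr (dmc_cells.hom (compcat_dmc K) (compcat_dmc K')))"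
proof -
  interpret subcategorical_pair K K' by fact
  interpret cat_functor "compcat_cells.hom K K'" "dmc_cells.hom (compcat_dmc K) (compcat_dmc K')" "forget_hom K K'"
    by (rule cat_functor_forget_hom[OF assms])
  have "bij_betw MBase (Obj (compcat_cells.hom K K')) (Obj (dmc_cells.hom (compcat_dmc K) (compcat_dmc K')))"
    using bij_betw_MBase by (simp add: compcat_cells.hom_def dmc_cells.hom_def)
  then show "bij_betw (OMap (forget_hom K K')) (Obj (compcat_cells.hom K K')) (Obj (dmc_cells.hom (compcat_dmc K) (compcat_dmc K')))"
    by (rule bij_betw_cong[THEN iffD1, rotated]) simp
  show "bij_betw (AMap (forget_hom K K')) (Arr (compcat_cells.hom K K')) (Arr (dmc_cells.hom (compcat_dmc K) (compcat_dmc K')))"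
  proof (rule bij_betwI)
    \<comment> \<open>The inverse rebuilds the two tags along with the body; recovering the tags of
      \<sigma> relies on strict maps being determined by their base functors.\<close>
    let ?g = "\<lambda>\<rho>. Cell2 (square_ccmap K (src2 \<rho>)) (square_cctrans K (src2 \<rho>) (trg2 \<rho>) (body2 \<rho>))
      (square_ccmap K (trg2 \<rho>))"
    have g: "transformation K K' (square_ccmap K F) (square_ccmap K G) (square_cctrans K F G \<alpha>)"
      if "dmc_map (compcat_dmc K) (compcat_dmc K') F" "dmc_map (compcat_dmc K) (compcat_dmc K') G"
        "nat_trans (Base K) (Base K') F G \<alpha>" for F G \<alpha>
      using transformation_square_cctrans[OF that(1,2)[THEN strict_map_square_ccmap]] that(3)
      by (simp add: square_ccmap_def)
    show "AMap (forget_hom K K') \<in> Arr (compcat_cells.hom K K') \<rightarrow> Arr (dmc_cells.hom (compcat_dmc K) (compcat_dmc K'))"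
      using AMap_arr(1) by blast
    show "?g \<in> Arr (dmc_cells.hom (compcat_dmc K) (compcat_dmc K')) \<rightarrow> Arr (compcat_cells.hom K K')"
      using g by simp
    show "?g (AMap (forget_hom K K') \<sigma>) = \<sigma>" if "\<sigma> \<in> Arr (compcat_cells.hom K K')" for \<sigma>
    proof -
      have \<sigma>: "transformation K K' (src2 \<sigma>) (trg2 \<sigma>) (body2 \<sigma>)"
        using that by simp
      then have "strict_map K K' (src2 \<sigma>)" "strict_map K K' (trg2 \<sigma>)"
        by (simp_all add: transformation.axioms)
      from this[THEN strict_map_eq_square_ccmap] transformation_eq_square_cctrans[OF \<sigma>] show ?thesis
        using \<sigma> by (cases \<sigma>) simp
    qed
    show "AMap (forget_hom K K') (?g \<rho>) = \<rho>" if "\<rho> \<in> Arr (dmc_cells.hom (compcat_dmc K) (compcat_dmc K'))" for \<rho>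
      using that g[of "src2 \<rho>" "trg2 \<rho>" "body2 \<rho>"]
      by (cases \<rho>) (simp add: square_ccmap_def square_cctrans_def)
  qed
qed

text \<open>The base parts of \<open>ccmap_id\<close>, \<open>ccmap_comp\<close> and
  \<open>cctrans_hcomp\<close> are the operations of \<open>sDMC\<close> on base parts, so the
  equations hold by unfolding; what has to be supplied is that the cells involved lie in their hom
  categories.\<close>

lemma two_functor_forget:
  "two_functor CompCat_str_sub sDMC \<lparr> F0 = compcat_dmc, FHom = forget_hom \<rparr>"
proof (intro two_functor.intro two_functor_axioms.intro, goal_cases)
  case 1
  then show ?case
    unfolding CompCat_str_sub_def by (rule two_category_full_sub[OF two_category_CompCat_str])
next
  case (5 K)
  then have "strict_map K K (ccmap_id K)"
    by (intro strict_map_id)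
      (simp add: subcategorical_comprehension_category_def full_comprehension_category_def)
  then show ?case
    by (simp add: ccmap_id_def)
next
  case (6 K K' K'' M N)
  then have M: "strict_map K K' M" and N: "strict_map K' K'' N"
    and pairs: "subcategorical_pair K K'" "subcategorical_pair K' K''"
    by (simp_all add: subcategorical_pair_def)
  show ?case
    using M N strict_map_comp[OF M N] subcategorical_pair.dmc_map_MBase[OF pairs(1) M] subcategorical_pair.dmc_map_MBase[OF pairs(2) N]
    by (simp add: ccmap_comp_def)
next
  case (7 K K' K'' \<sigma> \<tau>)
  then have \<sigma>: "transformation K K' (src2 \<sigma>) (trg2 \<sigma>) (body2 \<sigma>)"
    and \<tau>: "transformation K' K'' (src2 \<tau>) (trg2 \<tau>) (body2 \<tau>)"
    and pairs: "subcategorical_pair K K'" "subcategorical_pair K' K''"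
    by (simp_all add: subcategorical_pair_def)
  show ?case
    using \<sigma> \<tau> transformation_hcomp[OF \<sigma> \<tau>] subcategorical_pair.dmc_cell_if_transformation[OF pairs(1) \<sigma>]
      subcategorical_pair.dmc_cell_if_transformation[OF pairs(2) \<tau>]
    by (simp add: ccmap_comp_def cctrans_hcomp_def)
qed (simp_all add: two_category_sDMC subcategorical_pair_def cat_functor_forget_hom
    subcategorical_comprehension_category.display_map_category_compcat_dmc)

theorem theorem22:
  "isomorphic_two_categories (sDMC :: ('o, 'a) sDMC_twocat)
     (CompCat_str_sub :: ('o, 'a, 'a, 'a square) CompCat_twocat)"
proof (rule two_functor.isomorphic_if_bijective[OF two_functor_forget])
  show "bij_betw (F0 \<lparr> F0 = compcat_dmc, FHom = forget_hom \<rparr>) (Cells0 CompCat_str_sub) (Cells0 sDMC)"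
    \<comment> \<open>The set comprehensions of that lemma are folded back into the 0-cells of the
      two 2-categories.\<close>
    using bij_betw_compcat_dmc by (simp flip: CompCat_str_sub_simps(1) sDMC_simps(1))
qed (simp_all add: subcategorical_pair_def bij_betw_forget_hom)

end
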